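(* Let $p$ be a prime, $d\ge1$, let $f:\mathbb{Z}_p^d\to\mathbb{Z}_p^d$ be a polynomial map with coefficients in $\mathbb{Z}_p$, and let $x\in\mathbb{Z}_p^d$ be arbitrary. Then: (1) Either there exists a constant $C_0$ such that $\mathrm{Per}_{f_n}(x)\le C_0$ for all $n\ge1$, or there exist constants $C_1,C_2>0$ such that for all $n\ge1$ $$C_1p^n\le \mathrm{Per}_{f_n}(x)\le C_2p^n.$$ (2) There exists $C_3\ge0$ such that $\mathrm{Tail}_{f_n}(x)\le nC_3$ for all $n\ge1$. In particular, the size of the orbit of $x$ under $f_n$ is $O(p^n)$.
   Context: A polynomial map with coefficients in $\mathbb{Z}_p$ is $f=(f_1,\dots,f_d)$ with each $f_j\in\mathbb{Z}_p[X_1,\dots,X_d]$. For $n\ge1$, $f_n:(\mathbb{Z}/p^n\mathbb{Z})^d\to(\mathbb{Z}/p^n\mathbb{Z})^d$ is the map induced by $f$ modulo $p^n$. For a self-map $g$ of a finite set and a point $s$, $\mathrm{Tail}_g(s)$ is the least $D\ge0$ such that $g^D(s)$ is periodic, and $\mathrm{Per}_g(s)$ is the least $T\ge1$ with $g^{D+T}(s)=g^D(s)$, where $D=\mathrm{Tail}_g(s)$. For $x\in\mathbb{Z}_p^d$, $\mathrm{Per}_{f_n}(x)$ and $\mathrm{Tail}_{f_n}(x)$ mean these quantities for $g=f_n$ at $s=x\bmod p^n$; the orbit of $x$ under $f_n$ is $\{f_n^j(x\bmod p^n):j\ge0\}$. *)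

theory Defs
  imports
    Complex_Main
    "HOL-Algebra.Indexed_Polynomials"
    "HOL-Number_Theory.Residues"
    "HOL-Library.Landau_Symbols"
begin

text \<open>
  The ring of \<open>p\<close>-adic integers is the inverse limit of the rings \<open>\<int>/p\<^sup>n\<int>\<close>: an element is the
  compatible sequence of its residues, each represented in \<open>{0..<p\<^sup>n}\<close>, so that \<open>a n\<close> is
  the reduction of \<open>a\<close> modulo \<open>p\<^sup>n\<close>.
\<close>

type_synonym padic = "nat \<Rightarrow> int"

definition padic_ints :: "nat \<Rightarrow> padic ring" where
  "padic_ints p =
     \<lparr>carrier = {a. \<forall>n. a n \<in> {0..<int p ^ n} \<and> a (Suc n) mod int p ^ n = a n},
      monoid.mult = (\<lambda>a b n. (a n * b n) mod int p ^ n),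
      one = (\<lambda>n. 1 mod int p ^ n),
      zero = (\<lambda>n. 0),
      add = (\<lambda>a b n. (a n + b n) mod int p ^ n)\<rparr>"

text \<open>
  As in \<^theory>\<open>HOL-Algebra.Indexed_Polynomials\<close>, monomials are multisets of variables and a
  polynomial is its coefficient function. The library only evaluates one variable at a time, by
  another polynomial; the following is evaluation at a point.
\<close>

definition mpoly_eval :: "('a, 'm) ring_scheme \<Rightarrow> ('i multiset \<Rightarrow> 'a) \<Rightarrow> ('i \<Rightarrow> 'a) \<Rightarrow> 'a" where
  "mpoly_eval R P v =
     (\<Oplus>\<^bsub>R\<^esub>m\<in>{m. P m \<noteq> \<zero>\<^bsub>R\<^esub>}. P m \<otimes>\<^bsub>R\<^esub> (\<Otimes>\<^bsub>R\<^esub>i\<in>set_mset m. v i [^]\<^bsub>R\<^esub> count m i))"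

definition mpoly_map ::
  "('a, 'm) ring_scheme \<Rightarrow> nat \<Rightarrow> (nat \<Rightarrow> nat multiset \<Rightarrow> 'a) \<Rightarrow> (nat \<Rightarrow> 'a) \<Rightarrow> (nat \<Rightarrow> 'a)" where
  "mpoly_map R d f v = (\<lambda>j\<in>{..<d}. mpoly_eval R (f j) v)"

definition reduce_point :: "nat \<Rightarrow> nat \<Rightarrow> (nat \<Rightarrow> padic) \<Rightarrow> (nat \<Rightarrow> int)" where
  "reduce_point d n x = (\<lambda>i\<in>{..<d}. x i n)"

text \<open>
  The map on \<open>(\<int>/p\<^sup>n\<int>)\<^sup>d\<close> induced by \<open>f\<close>: reduce all coefficients of \<open>f\<close> modulo \<open>p\<^sup>n\<close> and evaluate in
  \<open>\<int>/p\<^sup>n\<int>\<close>. Lemmas \<open>induced_map_reduce_point\<close> and \<open>reduce_point_surj\<close> below show that this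
  is the unique map compatible with \<open>f\<close> and reduction modulo \<open>p\<^sup>n\<close>.
\<close>

definition induced_map ::
  "nat \<Rightarrow> nat \<Rightarrow> (nat \<Rightarrow> nat multiset \<Rightarrow> padic) \<Rightarrow> nat \<Rightarrow> (nat \<Rightarrow> int) \<Rightarrow> (nat \<Rightarrow> int)" where
  "induced_map p d f n = mpoly_map (residue_ring (int p ^ n)) d (\<lambda>j m. f j m n)"

definition is_periodic :: "('a \<Rightarrow> 'a) \<Rightarrow> 'a \<Rightarrow> bool" where
  "is_periodic g s \<longleftrightarrow> (\<exists>T\<ge>1. (g ^^ T) s = s)"

definition tail_length :: "('a \<Rightarrow> 'a) \<Rightarrow> 'a \<Rightarrow> nat" where
  "tail_length g s = (LEAST D. is_periodic g ((g ^^ D) s))"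

definition period :: "('a \<Rightarrow> 'a) \<Rightarrow> 'a \<Rightarrow> nat" where
  "period g s =
     (LEAST T. T \<ge> 1 \<and> (g ^^ (tail_length g s + T)) s = (g ^^ tail_length g s) s)"

definition forward_orbit :: "('a \<Rightarrow> 'a) \<Rightarrow> 'a \<Rightarrow> 'a set" where
  "forward_orbit g s = range (\<lambda>j. (g ^^ j) s)"


lemma padic_ints_simps:
  "a \<in> carrier (padic_ints p) \<longleftrightarrow>
     (\<forall>n. a n \<in> {0..<int p ^ n} \<and> a (Suc n) mod int p ^ n = a n)"
  "a \<otimes>\<^bsub>padic_ints p\<^esub> b = (\<lambda>n. (a n * b n) mod int p ^ n)"
  "\<one>\<^bsub>padic_ints p\<^esub> = (\<lambda>n. 1 mod int p ^ n)"
  "\<zero>\<^bsub>padic_ints p\<^esub> = (\<lambda>n. 0)"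
  "a \<oplus>\<^bsub>padic_ints p\<^esub> b = (\<lambda>n. (a n + b n) mod int p ^ n)"
  by (auto simp: padic_ints_def)

lemma padic_intsI:
  assumes "p > 0" "\<And>n. [F (Suc n) = F n] (mod int p ^ n)"
  shows "(\<lambda>n. F n mod int p ^ n) \<in> carrier (padic_ints p)"
  using assms by (auto simp: padic_ints_simps cong_def mod_mod_cancel)

lemma padic_ints_cong:
  assumes "a \<in> carrier (padic_ints p)"
  shows "[a (Suc n) = a n] (mod int p ^ n)" "a n mod int p ^ n = a n"
proof -
  have "0 \<le> a n" "a n < int p ^ n" "a (Suc n) mod int p ^ n = a n"
    using assms by (auto simp: padic_ints_simps)
  thus "[a (Suc n) = a n] (mod int p ^ n)" "a n mod int p ^ n = a n"
    by (auto simp: cong_def)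
qed

lemma padic_ints_cring:
  assumes "p > 0"
  shows "cring (padic_ints p)"
proof (rule cringI)
  let ?R = "padic_ints p"
  note cl = padic_intsI[OF assms]
  note cg = padic_ints_cong
  show "abelian_group ?R"
  proof (rule abelian_groupI)
    fix a assume a: "a \<in> carrier ?R"
    have "(\<lambda>n. (- a n) mod int p ^ n) \<in> carrier ?R"
      by (rule cl) (intro cong_minus_minus_iff[THEN iffD2] cg a)
    moreover have "(\<lambda>n. (- a n) mod int p ^ n) \<oplus>\<^bsub>?R\<^esub> a = \<zero>\<^bsub>?R\<^esub>"
      by (auto simp: padic_ints_simps mod_simps)
    ultimately show "\<exists>b\<in>carrier ?R. b \<oplus>\<^bsub>?R\<^esub> a = \<zero>\<^bsub>?R\<^esub>" by blast
  next
    fix a b assume "a \<in> carrier ?R" "b \<in> carrier ?R"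
    thus "a \<oplus>\<^bsub>?R\<^esub> b \<in> carrier ?R"
      unfolding padic_ints_simps(5) by (intro cl cong_add cg)
  next
    show "\<zero>\<^bsub>?R\<^esub> \<in> carrier ?R" using assms by (auto simp: padic_ints_simps)
  next
    fix a assume "a \<in> carrier ?R"
    thus "\<zero>\<^bsub>?R\<^esub> \<oplus>\<^bsub>?R\<^esub> a = a" using cg(2) by (auto simp: padic_ints_simps(4,5))
  qed (auto simp: padic_ints_simps(5) mod_simps algebra_simps)
  show "comm_monoid ?R"
  proof (rule comm_monoidI)
    fix a b assume "a \<in> carrier ?R" "b \<in> carrier ?R"
    thus "a \<otimes>\<^bsub>?R\<^esub> b \<in> carrier ?R"
      unfolding padic_ints_simps(2) by (intro cl cong_mult cg)
  next
    show "\<one>\<^bsub>?R\<^esub> \<in> carrier ?R" unfolding padic_ints_simps(3) by (rule cl) simp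
  next
    fix a assume "a \<in> carrier ?R"
    thus "\<one>\<^bsub>?R\<^esub> \<otimes>\<^bsub>?R\<^esub> a = a" using cg(2) by (auto simp: padic_ints_simps(2,3) mod_simps)
  qed (auto simp: padic_ints_simps(2) mod_simps algebra_simps)
qed (auto simp: padic_ints_simps(2,5) mod_simps algebra_simps)

lemma residue_ring_power:
  assumes "p > 1" "n \<ge> 1"
  shows "residues (int p ^ n)" "cring (residue_ring (int p ^ n))"
proof -
  show *: "residues (int p ^ n)"
    using assms by unfold_locales auto
  show "cring (residue_ring (int p ^ n))"
    using residues.cring[OF *] by simp
qed

lemma reduction_ring_hom:
  assumes "p > 1" "n \<ge> 1"
  shows "(\<lambda>a. a n) \<in> ring_hom (padic_ints p) (residue_ring (int p ^ n))"
proof -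
  have "int p ^ n > 1" using assms by auto
  thus ?thesis
    by (intro ring_hom_memI) (auto simp: padic_ints_simps residue_ring_def)
qed

lemma (in ring) indexed_pset_finite_support:
  assumes "P \<in> indexed_pset I (carrier R)"
  shows "finite {m. P m \<noteq> \<zero>}"
  using assms
proof induction
  case (indexed_const k)
  show ?case by (rule finite_subset[of _ "{{#}}"]) (auto simp: indexed_const_def)
next
  case (indexed_padd P Q)
  have "{m. (P \<Oplus> Q) m \<noteq> \<zero>} \<subseteq> {m. P m \<noteq> \<zero>} \<union> {m. Q m \<noteq> \<zero>}"
    by (auto simp: indexed_padd_def)
  thus ?case using indexed_padd.IH by (meson finite_UnI finite_subset)
next
  case (indexed_pmult P i)
  have "{m. (P \<Otimes> i) m \<noteq> \<zero>} \<subseteq> add_mset i ` {m. P m \<noteq> \<zero>}"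
    by (force simp: indexed_pmult_def split: if_splits dest: insert_DiffM)
  thus ?case using indexed_pmult.IH by (meson finite_imageI finite_subset)
qed

lemma (in ring) indexed_pset_variables:
  assumes "P \<in> indexed_pset I (carrier R)" "P m \<noteq> \<zero>"
  shows "set_mset m \<subseteq> I"
  using assms
proof (induction arbitrary: m)
  case (indexed_const k)
  thus ?case by (auto simp: indexed_const_def split: if_splits)
next
  case (indexed_padd P Q)
  thus ?case by (cases "P m = \<zero>"; cases "Q m = \<zero>") (auto simp: indexed_padd_def)
next
  case (indexed_pmult P i)
  hence "i \<in># m" "P (m - {#i#}) \<noteq> \<zero>"
    by (auto simp: indexed_pmult_def split: if_splits)
  with indexed_pmult.IH[of "m - {#i#}"] indexed_pmult.hyps show ?case
    by (metis insert_DiffM insert_subset set_mset_add_mset_insert)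
qed

lemma induced_map_reduce_point:
  assumes "p > 1" "n \<ge> 1"
    and f: "\<forall>j<d. f j \<in> ring.indexed_pset (padic_ints p) {..<d} (carrier (padic_ints p))"
    and x: "x \<in> {..<d} \<rightarrow>\<^sub>E carrier (padic_ints p)"
  shows "induced_map p d f n (reduce_point d n x) =
         reduce_point d n (mpoly_map (padic_ints p) d f x)"
proof -
  let ?R = "padic_ints p" and ?S = "residue_ring (int p ^ n)"
  interpret R: cring ?R using assms padic_ints_cring by simp
  interpret S: cring ?S using assms residue_ring_power by simp
  interpret h: ring_hom_cring ?R ?S "\<lambda>a. a n"
    using reduction_ring_hom[OF assms(1,2)] by unfold_locales
  have "mpoly_eval ?S (\<lambda>m. f j m n) (reduce_point d n x) = mpoly_eval ?R (f j) x n"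
    if j: "j < d" for j
  proof -
    let ?M = "{m. f j m \<noteq> \<zero>\<^bsub>?R\<^esub>}"
    let ?t = "\<lambda>m. f j m \<otimes>\<^bsub>?R\<^esub> (\<Otimes>\<^bsub>?R\<^esub>i\<in>set_mset m. x i [^]\<^bsub>?R\<^esub> count m i)"
    let ?u = "\<lambda>m. f j m n \<otimes>\<^bsub>?S\<^esub> (\<Otimes>\<^bsub>?S\<^esub>i\<in>set_mset m. reduce_point d n x i [^]\<^bsub>?S\<^esub> count m i)"
    have P: "f j \<in> R.indexed_pset {..<d} (carrier ?R)" using f j by simp
    have fin: "finite ?M" by (rule R.indexed_pset_finite_support[OF P])
    have co: "f j m \<in> carrier ?R" for m
      using R.indexed_pset_in_carrier[OF _ P] by (simp add: R.carrier_coeff_def)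
    have vars: "set_mset m \<subseteq> {..<d}" if "m \<in> ?M" for m
      using R.indexed_pset_variables[OF P] that by simp
    have xc: "x i \<in> carrier ?R" if "m \<in> ?M" "i \<in># m" for i m
      using vars[OF that(1)] that(2) x by (auto simp: PiE_iff)
    have tc: "?t m \<in> carrier ?R" if "m \<in> ?M" for m
      using xc[OF that] co by (intro R.m_closed R.finprod_closed) auto
    have pow: "(a [^]\<^bsub>?R\<^esub> k) n = a n [^]\<^bsub>?S\<^esub> k" if "a \<in> carrier ?R" for a and k :: nat
      using that by (induction k) auto
    have tu: "?t m n = ?u m" if "m \<in> ?M" for m
    proof -
      have "(\<Otimes>\<^bsub>?R\<^esub>i\<in>set_mset m. x i [^]\<^bsub>?R\<^esub> count m i) n =
            (\<Otimes>\<^bsub>?S\<^esub>i\<in>set_mset m. (x i [^]\<^bsub>?R\<^esub> count m i) n)"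
        using xc[OF that] by (subst h.hom_finprod) (auto simp: o_def)
      also have "\<dots> = (\<Otimes>\<^bsub>?S\<^esub>i\<in>set_mset m. reduce_point d n x i [^]\<^bsub>?S\<^esub> count m i)"
        using xc[OF that] vars[OF that]
        by (intro S.finprod_cong') (auto simp: reduce_point_def pow subset_iff)
      finally show ?thesis
        using xc[OF that] co by (subst h.hom_mult) (auto intro!: R.finprod_closed)
    qed
    have "mpoly_eval ?R (f j) x n = (\<Oplus>\<^bsub>?S\<^esub>m\<in>?M. ?t m n)"
      unfolding mpoly_eval_def using tc by (subst h.hom_finsum) (auto simp: o_def)
    also have "\<dots> = (\<Oplus>\<^bsub>?S\<^esub>m\<in>?M. ?u m)"
      using tc by (intro S.finsum_cong') (auto simp: tu[symmetric])
    also have "\<dots> = (\<Oplus>\<^bsub>?S\<^esub>m\<in>{m. f j m n \<noteq> \<zero>\<^bsub>?S\<^esub>}. ?u m)"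
    proof (rule S.add.finprod_mono_neutral_cong_right[OF fin])
      show "{m. f j m n \<noteq> \<zero>\<^bsub>?S\<^esub>} \<subseteq> ?M" by (auto simp: padic_ints_simps residue_ring_def)
      show "?u \<in> ?M \<rightarrow> carrier ?S" using tc h.hom_closed by (auto simp: tu[symmetric])
      show "?u m = \<zero>\<^bsub>?S\<^esub>" if "m \<in> ?M - {m. f j m n \<noteq> \<zero>\<^bsub>?S\<^esub>}" for m
      proof -
        have "f j m n = \<zero>\<^bsub>?S\<^esub>" using that by simp
        moreover have "(\<Otimes>\<^bsub>?S\<^esub>i\<in>set_mset m. reduce_point d n x i [^]\<^bsub>?S\<^esub> count m i) \<in> carrier ?S"
          using that xc[of m] vars[of m] h.hom_closed
          by (intro S.finprod_closed) (auto simp: reduce_point_def subset_iff)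
        ultimately show ?thesis by simp
      qed
    qed auto
    finally show ?thesis by (simp add: mpoly_eval_def)
  qed
  thus ?thesis
    by (auto simp: induced_map_def mpoly_map_def reduce_point_def restrict_def fun_eq_iff)
qed

lemma reduce_point_surj:
  assumes "p > 1"
  shows "reduce_point d n ` ({..<d} \<rightarrow>\<^sub>E carrier (padic_ints p)) =
         ({..<d} \<rightarrow>\<^sub>E carrier (residue_ring (int p ^ n)))" (is "?A = ?B")
proof
  show "?A \<subseteq> ?B"
    by (force simp: reduce_point_def padic_ints_simps residue_ring_def PiE_iff)
  show "?B \<subseteq> ?A"
  proof
    fix s assume s: "s \<in> ?B"
    let ?x = "\<lambda>i\<in>{..<d}. (\<lambda>k. s i mod int p ^ k)"
    have "?x \<in> {..<d} \<rightarrow>\<^sub>E carrier (padic_ints p)"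
      using assms padic_intsI[of p "\<lambda>_. s i" for i] by auto
    moreover have "reduce_point d n ?x = s"
      using s by (auto simp: reduce_point_def residue_ring_def fun_eq_iff PiE_iff extensional_def)
    ultimately show "s \<in> ?A" by (metis image_eqI)
  qed
qed

end

theory Submission
  imports Defs
begin

text \<open>
Let \<open>y\<^sub>j = f\<^sup>j(x)\<close> be the orbit in \<open>\<int>\<^sub>p\<^sup>d\<close>, and let \<open>v\<close> be the \<open>p\<close>-adic valuation of a vector, the minimum
of the valuations of its coordinates. Taylor expansion shows that for \<open>y\<^sub>i\<close> and \<open>y\<^sub>j\<close> in a common residue
class modulo \<open>p\<^sup>2\<close> the difference \<open>y\<^sub>i\<^sub>+\<^sub>1 - y\<^sub>j\<^sub>+\<^sub>1\<close> agrees with the image of \<open>y\<^sub>i - y\<^sub>j\<close> under the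
Jacobian matrix of that class up to \<open>p\<close>-adic order \<open>v(y\<^sub>i - y\<^sub>j) + 2\<close> (lemma
\<open>padic_polynomial_map_linearization\<close>). Modulo \<open>p\<^sup>2\<close> the orbit is eventually periodic, so one matrix
describes a full turn for all pairs of points in one class of the cycle; and some power of this
matrix is idempotent modulo \<open>p\<^sup>2\<close>. Hence there are \<open>t\<close> and \<open>L\<close> such that the subsequence
\<open>w\<^sub>k = y\<^sub>t\<^sub>+\<^sub>k\<^sub>L\<close> satisfies, for all \<open>i\<close> and \<open>j\<close>,

  \<open>w\<^sub>i\<^sub>+\<^sub>2 - w\<^sub>j\<^sub>+\<^sub>2 \<equiv> w\<^sub>i\<^sub>+\<^sub>1 - w\<^sub>j\<^sub>+\<^sub>1\<close> up to order \<open>v(w\<^sub>i - w\<^sub>j) + 2\<close>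

(lemma \<open>second_differences_of_subsequence\<close>). The matrix may be singular; its nilpotent part only
shows in the fact that this compares the second step with the first one, and not with the
initial difference.

This congruence forces a dichotomy (lemma \<open>second_difference_dichotomy\<close>). If
\<open>v(w\<^sub>s\<^sub>+\<^sub>1 - w\<^sub>s) \<ge> s\<close> for all \<open>s\<close>, then modulo \<open>p\<^sup>n\<close> the sequence \<open>w\<close> is constant from the index \<open>n\<close> on,
so the period of the orbit is at most \<open>L\<close> and its tail at most \<open>t + nL\<close>. Otherwise the increments have a
constant valuation \<open>\<mu>\<close> from some index on and no longer change modulo \<open>p\<^sup>\<mu>\<^sup>+\<^sup>2\<close>; adding up \<open>p\<close> of
them yields increments of valuation \<open>\<mu> + 1\<close> for the shift by \<open>p\<close>, and inductively
\<open>v(w\<^sub>s\<^sub>+\<^sub>q - w\<^sub>s) = \<mu> + k\<close> for \<open>q = p\<^sup>k\<close> and \<open>s \<ge> \<mu> + 1 + k\<close> (lemma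
\<open>differences_of_prime_power_shifts\<close>). So modulo \<open>p\<^sup>n\<close> with \<open>n = \<mu> + k\<close> the sequence \<open>w\<close> has exact
period \<open>p\<^sup>k\<close>, reached after \<open>O(n)\<close> steps, and the period of the orbit lies between \<open>p\<^sup>n\<^sup>-\<^sup>\<mu>\<close> and
\<open>L p\<^sup>n\<^sup>-\<^sup>\<mu>\<close>.
\<close>

section \<open>Tails, periods and return times\<close>

lemma funpow_return_shift:
  fixes g :: "'a \<Rightarrow> 'a"
  assumes "(g ^^ (t + L)) s = (g ^^ t) s" "t \<le> r"
  shows "(g ^^ (r + k * L)) s = (g ^^ r) s"
proof -
  have *: "(g ^^ (r' + L)) s = (g ^^ r') s" if "t \<le> r'" for r'
  proof -
    have "(g ^^ (r' + L)) s = (g ^^ (r' - t)) ((g ^^ (t + L)) s)"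
      using that by (simp flip: funpow_add comp_apply[of "g ^^ _"] add: ac_simps)
    also have "\<dots> = (g ^^ r') s"
      using that assms(1) by (simp flip: funpow_add comp_apply[of "g ^^ _"])
    finally show ?thesis .
  qed
  show ?thesis
  proof (induction k)
    case (Suc k)
    have "(g ^^ (r + Suc k * L)) s = (g ^^ ((r + k * L) + L)) s" by (simp add: ac_simps)
    also have "\<dots> = (g ^^ (r + k * L)) s" by (rule *) (use assms(2) in simp)
    finally show ?case using Suc by simp
  qed simp
qed

lemma tail_period_bounds:
  assumes ret: "(g ^^ (t + L)) s = (g ^^ t) s" and L: "L \<ge> 1"
  shows "tail_length g s \<le> t" "period g s \<le> L" "period g s \<ge> 1"
    "(g ^^ (tail_length g s + period g s)) s = (g ^^ tail_length g s) s"
proof -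
  let ?D = "tail_length g s"
  have per: "is_periodic g ((g ^^ t) s)"
    using ret L by (auto simp: is_periodic_def funpow_add add.commute intro!: exI[of _ L])
  show "?D \<le> t" unfolding tail_length_def using per by (rule Least_le)
  have "is_periodic g ((g ^^ ?D) s)"
    unfolding tail_length_def using per by (rule LeastI)
  then obtain T where T: "T \<ge> 1" "(g ^^ (?D + T)) s = (g ^^ ?D) s"
    by (auto simp: is_periodic_def funpow_add add.commute)
  have return_D: "(g ^^ (?D + t * T)) s = (g ^^ ?D) s"
    by (rule funpow_return_shift[OF T(2)]) simp
  \<comment> \<open>\<open>L\<close> is a return time at \<open>t\<close>, which may lie beyond the end \<open>?D\<close> of the tail. Going round the
      cycle \<open>t\<close> times moves the point at \<open>?D\<close> past \<open>t\<close> without changing it.\<close>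
  have "(g ^^ (?D + L)) s = (g ^^ (?D + L + t * T)) s"
    by (rule funpow_return_shift[OF T(2), symmetric]) simp
  also have "\<dots> = (g ^^ ((?D + t * T) + 1 * L)) s" by (simp add: ac_simps)
  also have "\<dots> = (g ^^ (?D + t * T)) s"
    by (rule funpow_return_shift[OF ret]) (use T(1) in \<open>simp add: trans_le_add2\<close>)
  finally have R: "L \<ge> 1 \<and> (g ^^ (?D + L)) s = (g ^^ ?D) s" using return_D L by simp
  show "period g s \<le> L" unfolding period_def using R by (rule Least_le)
  have "period g s \<ge> 1 \<and> (g ^^ (?D + period g s)) s = (g ^^ ?D) s"
    unfolding period_def by (rule LeastI[of _ L]) (rule R)
  thus "period g s \<ge> 1" "(g ^^ (?D + period g s)) s = (g ^^ ?D) s" by auto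
qed

lemma card_forward_orbit_le:
  assumes ret: "(g ^^ (t + L)) s = (g ^^ t) s" and L: "L \<ge> 1"
  shows "card (forward_orbit g s) \<le> tail_length g s + period g s"
proof -
  let ?D = "tail_length g s" and ?T = "period g s"
  note b = tail_period_bounds[OF assms]
  have "forward_orbit g s \<subseteq> (\<lambda>j. (g ^^ j) s) ` {..<?D + ?T}"
  proof
    fix a assume "a \<in> forward_orbit g s"
    then obtain j where j: "a = (g ^^ j) s" by (auto simp: forward_orbit_def)
    show "a \<in> (\<lambda>j. (g ^^ j) s) ` {..<?D + ?T}"
    proof (cases "j < ?D")
      case False
      let ?r = "?D + (j - ?D) mod ?T"
      have "(g ^^ (?r + ((j - ?D) div ?T) * ?T)) s = (g ^^ ?r) s"
        by (rule funpow_return_shift[OF b(4)]) simp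
      moreover have "?r + ((j - ?D) div ?T) * ?T = j"
        using False mod_div_mult_eq[of "j - ?D" ?T] by linarith
      moreover have "?r < ?D + ?T" using b(3) by simp
      ultimately show ?thesis using j by (metis imageI lessThan_iff)
    qed (use j in auto)
  qed
  hence "card (forward_orbit g s) \<le> card ((\<lambda>j. (g ^^ j) s) ` {..<?D + ?T})"
    by (intro card_mono) auto
  also have "\<dots> \<le> ?D + ?T" using card_image_le[of "{..<?D + ?T}" "\<lambda>j. (g ^^ j) s"] by simp
  finally show ?thesis .
qed

text \<open>
The minimal return time divides \<open>p\<^sup>k\<^sup>+\<^sup>1\<close> and does not divide \<open>p\<^sup>k\<close>, so it is \<open>p\<^sup>k\<^sup>+\<^sup>1\<close>. This
turns a point that returns after \<open>p\<^sup>k\<^sup>+\<^sup>1\<close> but not after \<open>p\<^sup>k\<close> steps into a lower bound for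
periods.
\<close>

lemma prime_power_return_time_le:
  fixes p a :: nat
  assumes "prime p" and big: "(h ^^ (p ^ Suc k)) s = s" and small: "(h ^^ (p ^ k)) s \<noteq> s"
    and a: "(h ^^ a) s = s" "a \<ge> 1"
  shows "p ^ Suc k \<le> a"
proof -
  define b where "b = (LEAST b. b \<ge> 1 \<and> (h ^^ b) s = s)"
  have b: "b \<ge> 1" "(h ^^ b) s = s"
    using LeastI[of "\<lambda>b. b \<ge> 1 \<and> (h ^^ b) s = s" a] a unfolding b_def by auto
  have least: "b \<le> c" if "c \<ge> 1" "(h ^^ c) s = s" for c
    unfolding b_def by (rule Least_le) (use that in simp)
  have dvd: "b dvd c" if "(h ^^ c) s = s" for c
  proof (rule ccontr)
    assume "\<not> b dvd c"
    hence "c mod b \<ge> 1" by (simp add: dvd_eq_mod_eq_0)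
    moreover have "(h ^^ (c mod b)) s = s" using funpow_mod_eq[OF b(2), of c] that by simp
    ultimately have "b \<le> c mod b" by (rule least)
    thus False using b(1) mod_less_divisor[of b c] by linarith
  qed
  obtain i where i: "i \<le> Suc k" "b = p ^ i"
    using dvd[OF big] divides_primepow_nat[OF assms(1)] by blast
  have "i = Suc k"
  proof (rule ccontr)
    assume "i \<noteq> Suc k"
    hence "b dvd p ^ k" using i by (simp add: le_imp_power_dvd)
    then obtain q where "p ^ k = q * b" by (metis dvdE mult.commute)
    hence "(h ^^ (p ^ k)) s = s" using funpow_mod_eq[OF b(2), of "p ^ k"] by simp
    with small show False by simp
  qed
  with i least[OF a(2,1)] show ?thesis by simp
qed

section \<open>Integer vectors and operators modulo powers\<close>

definition vec_cong :: "nat \<Rightarrow> int \<Rightarrow> (nat \<Rightarrow> int) \<Rightarrow> (nat \<Rightarrow> int) \<Rightarrow> bool" where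
  "vec_cong d q u v \<longleftrightarrow> (\<forall>c<d. [u c = v c] (mod q))"

lemma vec_cong_refl [simp]: "vec_cong d q u u"
  by (simp add: vec_cong_def)

lemma vec_cong_sym: "vec_cong d q u v \<Longrightarrow> vec_cong d q v u"
  by (auto simp: vec_cong_def cong_sym_eq)

lemma vec_cong_trans: "vec_cong d q u v \<Longrightarrow> vec_cong d q v w \<Longrightarrow> vec_cong d q u w"
  by (auto simp: vec_cong_def intro: cong_trans)

lemma vec_cong_dvd: "vec_cong d q u v \<Longrightarrow> r dvd q \<Longrightarrow> vec_cong d r u v"
  by (auto simp: vec_cong_def intro: cong_dvd_modulus)

text \<open>
The examples in view are the maps given by integer matrices. Respect for congruences to every
modulus and homogeneity are all that the iteration of a linearized map draws on, and both pass
to compositions without any computation with matrix entries.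
\<close>

definition integral_operator :: "nat \<Rightarrow> ((nat \<Rightarrow> int) \<Rightarrow> (nat \<Rightarrow> int)) \<Rightarrow> bool" where
  "integral_operator d \<phi> \<longleftrightarrow>
     (\<forall>q u v. vec_cong d q u v \<longrightarrow> vec_cong d q (\<phi> u) (\<phi> v)) \<and>
     (\<forall>q u. \<phi> (\<lambda>c. q * u c) = (\<lambda>c. q * \<phi> u c))"

lemma integral_operatorD:
  assumes "integral_operator d \<phi>"
  shows "vec_cong d q u v \<Longrightarrow> vec_cong d q (\<phi> u) (\<phi> v)"
    "\<phi> (\<lambda>c. q * u c) = (\<lambda>c. q * \<phi> u c)"
  using assms by (auto simp: integral_operator_def)

lemma integral_operator_matrix:
  "integral_operator d (\<lambda>u r. \<Sum>c<d. M r c * u c)"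
  by (auto simp: integral_operator_def vec_cong_def sum_distrib_left algebra_simps fun_eq_iff
           intro!: cong_sum cong_mult)

lemma integral_operator_id: "integral_operator d (\<lambda>u. u)"
  by (auto simp: integral_operator_def)

lemma integral_operator_comp:
  assumes "integral_operator d \<phi>" "integral_operator d \<psi>"
  shows "integral_operator d (\<lambda>u. \<phi> (\<psi> u))"
  using assms by (simp add: integral_operator_def)

lemma integral_operator_funpow:
  assumes "integral_operator d \<phi>"
  shows "integral_operator d (\<phi> ^^ n)"
proof (induction n)
  case 0
  show ?case using integral_operator_id by (simp add: id_def)
next
  case (Suc n)
  show ?case using integral_operator_comp[OF assms Suc] by (simp add: comp_def)
qed

text \<open>
The powers of an operator act on the finite set \<open>(\<int>/Q)\<^sup>d\<close>, so two of them agree modulo \<open>Q\<close>, and a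
finite cyclic semigroup contains an idempotent. Passing to the idempotent power splits off the
directions that the operator eventually kills modulo \<open>Q\<close> and makes it the identity on its
image modulo \<open>Q\<close>.
\<close>

lemma idempotent_power_mod:
  assumes op: "integral_operator d \<phi>" and "Q > 0"
  shows "\<exists>n\<ge>1. \<forall>u. vec_cong d Q ((\<phi> ^^ (2 * n)) u) ((\<phi> ^^ n) u)"
proof -
  define B where "B = ({..<d} \<rightarrow>\<^sub>E {0..<Q})"
  define red where "red = (\<lambda>u. \<lambda>c\<in>{..<d}. u c mod Q)"
  have B: "finite B" unfolding B_def by (auto intro: finite_PiE)
  have red: "red u \<in> B" for u using assms(2) by (auto simp: red_def B_def)
  have red_cong: "vec_cong d Q u (red u)" for u by (auto simp: red_def vec_cong_def cong_def)
  have red_eq: "vec_cong d Q u v" if "red u = red v" for u v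
    using vec_cong_trans[OF red_cong[of u], of v] red_cong[of v] that
    by (metis vec_cong_sym)
  let ?F = "\<lambda>j. \<lambda>u\<in>B. red ((\<phi> ^^ j) u)"
  have "range ?F \<subseteq> B \<rightarrow>\<^sub>E B" using red by auto
  hence "finite (range ?F)" by (rule finite_subset) (use B in \<open>auto intro: finite_PiE\<close>)
  hence "\<not> inj ?F" using finite_imageD[of ?F UNIV] by auto
  then obtain i' j' where ij': "i' \<noteq> j'" "?F i' = ?F j'" by (auto simp: inj_def)
  obtain i j where ij: "i < j" "?F i = ?F j"
    using ij' by (cases "i' < j'") (metis linorder_neqE_nat)+
  define r where "r = j - i"
  have r: "r \<ge> 1" using ij by (simp add: r_def)
  have step: "vec_cong d Q ((\<phi> ^^ i) u) ((\<phi> ^^ (i + r)) u)" for u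
  proof -
    have "red ((\<phi> ^^ i) (red u)) = red ((\<phi> ^^ j) (red u))"
      using fun_cong[OF ij(2), of "red u"] red by simp
    hence "vec_cong d Q ((\<phi> ^^ i) (red u)) ((\<phi> ^^ j) (red u))" by (rule red_eq)
    moreover have "vec_cong d Q ((\<phi> ^^ l) u) ((\<phi> ^^ l) (red u))" for l
      by (rule integral_operatorD(1)[OF integral_operator_funpow[OF op] red_cong])
    ultimately have "vec_cong d Q ((\<phi> ^^ i) u) ((\<phi> ^^ j) u)"
      by (meson vec_cong_sym vec_cong_trans)
    thus ?thesis using ij(1) by (simp add: r_def)
  qed
  have step': "vec_cong d Q ((\<phi> ^^ a) u) ((\<phi> ^^ (a + k * r)) u)" if "a \<ge> i" for a k u
  proof (induction k)
    case (Suc k)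
    have "vec_cong d Q ((\<phi> ^^ i) ((\<phi> ^^ (a + k * r - i)) u))
            ((\<phi> ^^ (i + r)) ((\<phi> ^^ (a + k * r - i)) u))" by (rule step)
    hence "vec_cong d Q ((\<phi> ^^ (a + k * r)) u) ((\<phi> ^^ (a + Suc k * r)) u)"
      using that by (simp flip: funpow_add comp_apply[of "\<phi> ^^ _"] add: ac_simps)
    with Suc show ?case by (rule vec_cong_trans)
  qed simp
  \<comment> \<open>A multiple of the period \<open>r\<close> of the powers that exceeds their preperiod \<open>i\<close>.\<close>
  let ?n = "Suc i * r"
  have "i \<le> ?n" using r by (metis Suc_leD le_refl mult.commute mult_le_mono nat_mult_1)
  hence "\<forall>u. vec_cong d Q ((\<phi> ^^ (2 * ?n)) u) ((\<phi> ^^ ?n) u)"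
    using step'[of ?n _ "Suc i"] by (metis mult_2 vec_cong_sym)
  moreover have "?n \<ge> 1" using r by simp
  ultimately show ?thesis by blast
qed

text \<open>
Homogeneity upgrades idempotence modulo \<open>Q\<close> to a congruence modulo \<open>q * Q\<close> on the vectors that are
divisible by \<open>q\<close>: the error is small relative to the vector.
\<close>

lemma idempotent_power_scaled:
  assumes op: "integral_operator d \<phi>"
    and idem: "\<And>u. vec_cong d Q ((\<phi> ^^ (2 * n)) u) ((\<phi> ^^ n) u)"
    and e: "vec_cong d q e (\<lambda>_. 0)"
  shows "vec_cong d (q * Q) ((\<phi> ^^ (2 * n)) e) ((\<phi> ^^ n) e)"
proof -
  define e0 where "e0 = (\<lambda>c. e c div q)"
  have e0: "vec_cong d (q * Q) e (\<lambda>c. q * e0 c)"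
    using e by (auto simp: vec_cong_def e0_def cong_0_iff)
  have *: "vec_cong d (q * Q) ((\<phi> ^^ l) e) (\<lambda>c. q * (\<phi> ^^ l) e0 c)" for l
    using integral_operatorD[OF integral_operator_funpow[OF op, of l]] e0 by metis
  have "vec_cong d (q * Q) (\<lambda>c. q * (\<phi> ^^ (2 * n)) e0 c) (\<lambda>c. q * (\<phi> ^^ n) e0 c)"
    using idem[of e0] by (auto simp: vec_cong_def cong_iff_dvd_diff simp flip: right_diff_distrib)
  thus ?thesis using * by (meson vec_cong_sym vec_cong_trans)
qed

section \<open>First-order expansion of \<open>p\<close>-adic polynomial maps\<close>

text \<open>
A factor that multiplies a quantity divisible by \<open>q\<close> matters only modulo \<open>Q\<close> when the product is
wanted modulo \<open>q * Q\<close>. This is why a derivative need only be known modulo \<open>Q\<close>.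
\<close>

lemma cong_mult_vanishing:
  fixes a b u v q Q :: int
  assumes "[a = b] (mod Q)" "[u = v] (mod (q * Q))" "q dvd v"
  shows "[a * u = b * v] (mod (q * Q))"
proof -
  have "q * Q dvd v * (a - b)"
    using assms(1,3) by (intro mult_dvd_mono) (auto simp: cong_iff_dvd_diff)
  hence "[a * v = b * v] (mod (q * Q))" by (simp add: cong_iff_dvd_diff algebra_simps)
  thus ?thesis using assms(2) by (meson cong_scalar_left cong_trans)
qed

lemma vec_cong_linear_form_dvd:
  assumes "vec_cong d q s t"
  shows "q dvd (\<Sum>i<d. G i * (s i - t i))"
  using assms by (intro dvd_sum dvd_mult) (auto simp: vec_cong_def cong_iff_dvd_diff)

lemma monomial_cong:
  assumes "set_mset m \<subseteq> {..<d}" "vec_cong d Q s t"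
  shows "[(\<Prod>i\<in>#m. s i) = (\<Prod>i\<in>#m. t i)] (mod Q)"
  using assms(1)
proof (induction m)
  case (add i m)
  thus ?case using assms(2) by (auto simp: vec_cong_def intro!: cong_mult)
qed simp

text \<open>
First-order Taylor expansion with an error that is relatively divisible by \<open>Q\<close>. The coefficients
\<open>G\<close> are the partial derivatives at \<open>a\<close>; they depend on the common residue \<open>a\<close> modulo \<open>Q\<close> of the
two points, and neither on the points nor on \<open>q\<close>.
\<close>

lemma monomial_linearization:
  assumes "set_mset m \<subseteq> {..<d}"
  shows "\<exists>G. \<forall>q s t. vec_cong d Q s a \<longrightarrow> vec_cong d Q t a \<longrightarrow> vec_cong d q s t \<longrightarrow>
           [(\<Prod>i\<in>#m. s i) - (\<Prod>i\<in>#m. t i) = (\<Sum>i<d. G i * (s i - t i))] (mod (q * Q))"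
  using assms
proof (induction m)
  case empty
  show ?case by (rule exI[of _ "\<lambda>_. 0"]) simp
next
  case (add k m)
  then obtain G where G: "\<And>q s t. vec_cong d Q s a \<Longrightarrow> vec_cong d Q t a \<Longrightarrow> vec_cong d q s t \<Longrightarrow>
           [(\<Prod>i\<in>#m. s i) - (\<Prod>i\<in>#m. t i) = (\<Sum>i<d. G i * (s i - t i))] (mod (q * Q))"
    by auto
  have k: "k < d" and m: "set_mset m \<subseteq> {..<d}" using add.prems by auto
  \<comment> \<open>Product rule, from \<open>s k * M s - t k * M t = M s * (s k - t k) + t k * (M s - M t)\<close>.\<close>
  define H where "H = (\<lambda>i. (if i = k then (\<Prod>i\<in>#m. a i) else 0) + a k * G i)"
  show ?case
  proof (intro exI[of _ H] allI impI)
    fix q s t assume s: "vec_cong d Q s a" and t: "vec_cong d Q t a" and st: "vec_cong d q s t"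
    have "[(\<Prod>i\<in>#m. s i) * (s k - t k) = (\<Prod>i\<in>#m. a i) * (s k - t k)] (mod (q * Q))"
      using monomial_cong[OF m s] st k
      by (intro cong_mult_vanishing) (auto simp: vec_cong_def cong_iff_dvd_diff)
    moreover have "[t k * ((\<Prod>i\<in>#m. s i) - (\<Prod>i\<in>#m. t i)) = a k * (\<Sum>i<d. G i * (s i - t i))] (mod (q * Q))"
      using G[OF s t st] t k vec_cong_linear_form_dvd[OF st]
      by (intro cong_mult_vanishing) (auto simp: vec_cong_def)
    ultimately have "[(\<Prod>i\<in>#m. s i) * (s k - t k) + t k * ((\<Prod>i\<in>#m. s i) - (\<Prod>i\<in>#m. t i)) =
        (\<Prod>i\<in>#m. a i) * (s k - t k) + a k * (\<Sum>i<d. G i * (s i - t i))] (mod (q * Q))"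
      by (rule cong_add)
    moreover have "(\<Prod>i\<in>#m. a i) * (s k - t k) + a k * (\<Sum>i<d. G i * (s i - t i)) =
        (\<Sum>i<d. H i * (s i - t i))"
    proof -
      have "(\<Sum>i<d. H i * (s i - t i)) = (\<Sum>i<d. (if i = k then (\<Prod>i\<in>#m. a i) * (s k - t k) else 0)
              + a k * (G i * (s i - t i)))"
        unfolding H_def by (intro sum.cong) (auto simp: algebra_simps)
      thus ?thesis using k by (simp add: sum.distrib sum_distrib_left)
    qed
    ultimately show "[(\<Prod>i\<in>#add_mset k m. s i) - (\<Prod>i\<in>#add_mset k m. t i) =
        (\<Sum>i<d. H i * (s i - t i))] (mod (q * Q))"
      by (simp add: algebra_simps)
  qed
qed

text \<open>
The coefficients \<open>b\<close> of the polynomial are themselves allowed to vary within a residue class modulo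
\<open>Q\<close>. For a polynomial over the \<open>p\<close>-adic integers this yields one linear form that serves for the
reductions of the polynomial to all levels at once.
\<close>

lemma polynomial_linearization:
  assumes "\<And>m. m \<in> A \<Longrightarrow> set_mset m \<subseteq> {..<d}"
  shows "\<exists>G. \<forall>q s t b. (\<forall>m\<in>A. [b m = \<alpha> m] (mod Q)) \<longrightarrow>
           vec_cong d Q s a \<longrightarrow> vec_cong d Q t a \<longrightarrow> vec_cong d q s t \<longrightarrow>
           [(\<Sum>m\<in>A. b m * (\<Prod>i\<in>#m. s i)) - (\<Sum>m\<in>A. b m * (\<Prod>i\<in>#m. t i)) =
            (\<Sum>i<d. G i * (s i - t i))] (mod (q * Q))"
proof -
  have "\<exists>G. m \<in> A \<longrightarrow> (\<forall>q s t. vec_cong d Q s a \<longrightarrow> vec_cong d Q t a \<longrightarrow> vec_cong d q s t \<longrightarrow>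
           [(\<Prod>i\<in>#m. s i) - (\<Prod>i\<in>#m. t i) = (\<Sum>i<d. G i * (s i - t i))] (mod (q * Q)))" for m
    using monomial_linearization[OF assms[of m]] by blast
  then obtain G where G: "\<And>m q s t. m \<in> A \<Longrightarrow> vec_cong d Q s a \<Longrightarrow> vec_cong d Q t a \<Longrightarrow>
      vec_cong d q s t \<Longrightarrow>
      [(\<Prod>i\<in>#m. s i) - (\<Prod>i\<in>#m. t i) = (\<Sum>i<d. G m i * (s i - t i))] (mod (q * Q))"
    by metis
  show ?thesis
  proof (intro exI[of _ "\<lambda>i. \<Sum>m\<in>A. \<alpha> m * G m i"] allI impI)
    fix q s t b
    assume b: "\<forall>m\<in>A. [b m = \<alpha> m] (mod Q)"
      and st: "vec_cong d Q s a" "vec_cong d Q t a" "vec_cong d q s t"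
    have "(\<Sum>m\<in>A. b m * (\<Prod>i\<in>#m. s i)) - (\<Sum>m\<in>A. b m * (\<Prod>i\<in>#m. t i)) =
          (\<Sum>m\<in>A. b m * ((\<Prod>i\<in>#m. s i) - (\<Prod>i\<in>#m. t i)))"
      by (simp add: sum_subtractf right_diff_distrib)
    also have "[\<dots> = (\<Sum>m\<in>A. \<alpha> m * (\<Sum>i<d. G m i * (s i - t i)))] (mod (q * Q))"
      by (intro cong_sum cong_mult_vanishing vec_cong_linear_form_dvd G st) (use b in auto)
    also have "(\<Sum>m\<in>A. \<alpha> m * (\<Sum>i<d. G m i * (s i - t i))) =
               (\<Sum>i<d. (\<Sum>m\<in>A. \<alpha> m * G m i) * (s i - t i))"
      unfolding sum_distrib_left sum_distrib_right mult.assoc by (rule sum.swap)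
    finally show "[(\<Sum>m\<in>A. b m * (\<Prod>i\<in>#m. s i)) - (\<Sum>m\<in>A. b m * (\<Prod>i\<in>#m. t i)) =
            (\<Sum>i<d. (\<Sum>m\<in>A. \<alpha> m * G m i) * (s i - t i))] (mod (q * Q))" .
  qed
qed

lemma padic_level_cong:
  assumes "a \<in> carrier (padic_ints p)" "n \<le> N"
  shows "[a N = a n] (mod int p ^ n)"
  using assms(2)
proof (induction N rule: dec_induct)
  case (step N)
  have "[a (Suc N) = a N] (mod int p ^ n)"
    by (rule cong_dvd_modulus[OF padic_ints_cong(1)[OF assms(1)]])
       (use step.hyps in \<open>simp add: le_imp_power_dvd\<close>)
  with step.IH show ?case by (rule cong_trans[rotated])
qed simp

lemma padic_finsum_level:
  assumes "p > 0" "g \<in> A \<rightarrow> carrier (padic_ints p)"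
  shows "[(finsum (padic_ints p) g A) n = (\<Sum>m\<in>A. g m n)] (mod int p ^ n)"
proof -
  interpret R: cring "padic_ints p" using assms(1) by (rule padic_ints_cring)
  show ?thesis
  proof (cases "finite A")
    case True
    thus ?thesis using assms(2)
    proof (induction A)
      case (insert m A)
      have "finsum (padic_ints p) g (insert m A) n =
            (g m n + finsum (padic_ints p) g A n) mod int p ^ n"
        using insert by (subst R.finsum_insert) (auto simp: padic_ints_simps(5))
      moreover have "[g m n + finsum (padic_ints p) g A n = g m n + (\<Sum>m\<in>A. g m n)] (mod int p ^ n)"
        using insert by (intro cong_add) auto
      ultimately show ?case using insert.hyps by (simp add: cong_def)
    qed (simp add: padic_ints_simps(4))
  qed (simp add: R.finsum_infinite padic_ints_simps(4))
qed

lemma padic_finprod_level: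
  assumes "p > 0" "g \<in> A \<rightarrow> carrier (padic_ints p)"
  shows "[(finprod (padic_ints p) g A) n = (\<Prod>m\<in>A. g m n)] (mod int p ^ n)"
proof -
  interpret R: cring "padic_ints p" using assms(1) by (rule padic_ints_cring)
  show ?thesis
  proof (cases "finite A")
    case True
    thus ?thesis using assms(2)
    proof (induction A)
      case (insert m A)
      have "finprod (padic_ints p) g (insert m A) n =
            (g m n * finprod (padic_ints p) g A n) mod int p ^ n"
        using insert by (subst R.finprod_insert) (auto simp: padic_ints_simps(2))
      moreover have "[g m n * finprod (padic_ints p) g A n = g m n * (\<Prod>m\<in>A. g m n)] (mod int p ^ n)"
        using insert by (intro cong_mult) auto
      ultimately show ?case using insert.hyps by (simp add: cong_def)
    qed (simp add: padic_ints_simps(3) cong_def)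
  qed (simp add: R.finprod_infinite padic_ints_simps(3) cong_def)
qed

lemma padic_power_level:
  fixes k :: nat
  assumes "p > 0"
  shows "[(a [^]\<^bsub>padic_ints p\<^esub> k) n = a n ^ k] (mod int p ^ n)"
proof -
  interpret R: cring "padic_ints p" using assms(1) by (rule padic_ints_cring)
  show ?thesis
  proof (induction k)
    case (Suc k)
    have "(a [^]\<^bsub>padic_ints p\<^esub> Suc k) n = ((a [^]\<^bsub>padic_ints p\<^esub> k) n * a n) mod int p ^ n"
      by (simp add: padic_ints_simps(2))
    moreover have "[(a [^]\<^bsub>padic_ints p\<^esub> k) n * a n = a n ^ k * a n] (mod int p ^ n)"
      using Suc by (rule cong_scalar_right)
    ultimately show ?case by (simp add: cong_def mult.commute)
  qed (simp add: padic_ints_simps(3) cong_def)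
qed

lemma padic_polynomial_value:
  assumes p: "p > 0"
    and P: "P \<in> ring.indexed_pset (padic_ints p) {..<d} (carrier (padic_ints p))"
    and v: "v \<in> {..<d} \<rightarrow>\<^sub>E carrier (padic_ints p)"
  shows "mpoly_eval (padic_ints p) P v \<in> carrier (padic_ints p)"
    "[mpoly_eval (padic_ints p) P v n =
        (\<Sum>m\<in>{m. P m \<noteq> \<zero>\<^bsub>padic_ints p\<^esub>}. P m n * (\<Prod>i\<in>#m. v i n))] (mod int p ^ n)"
proof -
  let ?R = "padic_ints p"
  interpret R: cring ?R using p by (rule padic_ints_cring)
  let ?M = "{m. P m \<noteq> \<zero>\<^bsub>?R\<^esub>}"
  let ?t = "\<lambda>m. P m \<otimes>\<^bsub>?R\<^esub> (\<Otimes>\<^bsub>?R\<^esub>i\<in>set_mset m. v i [^]\<^bsub>?R\<^esub> count m i)"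
  have co: "P m \<in> carrier ?R" for m
    using R.indexed_pset_in_carrier[OF _ P] by (simp add: R.carrier_coeff_def)
  have vc: "v i \<in> carrier ?R" if "m \<in> ?M" "i \<in># m" for i m
    using R.indexed_pset_variables[OF P, of m] that v by (auto simp: PiE_iff)
  have tc: "?t \<in> ?M \<rightarrow> carrier ?R"
    using vc co by (intro funcsetI R.m_closed R.finprod_closed) auto
  show "mpoly_eval ?R P v \<in> carrier ?R"
    unfolding mpoly_eval_def using tc by (rule R.finsum_closed)
  have summand: "[?t m n = P m n * (\<Prod>i\<in>#m. v i n)] (mod int p ^ n)" if m: "m \<in> ?M" for m
  proof -
    have "[(\<Otimes>\<^bsub>?R\<^esub>i\<in>set_mset m. v i [^]\<^bsub>?R\<^esub> count m i) n =
           (\<Prod>i\<in>set_mset m. (v i [^]\<^bsub>?R\<^esub> count m i) n)] (mod int p ^ n)"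
      using vc[OF m] by (intro padic_finprod_level[OF p]) auto
    also have "[(\<Prod>i\<in>set_mset m. (v i [^]\<^bsub>?R\<^esub> count m i) n) =
                (\<Prod>i\<in>set_mset m. v i n ^ count m i)] (mod int p ^ n)"
      by (intro cong_prod padic_power_level p)
    also have "(\<Prod>i\<in>set_mset m. v i n ^ count m i) = (\<Prod>i\<in>#m. v i n)"
      by (rule image_prod_mset_multiplicity[symmetric])
    finally have "[P m n * (\<Otimes>\<^bsub>?R\<^esub>i\<in>set_mset m. v i [^]\<^bsub>?R\<^esub> count m i) n =
                   P m n * (\<Prod>i\<in>#m. v i n)] (mod int p ^ n)"
      by (rule cong_scalar_left)
    thus ?thesis unfolding padic_ints_simps(2) by (simp only: cong_def mod_mod_trivial)
  qed
  have "[mpoly_eval ?R P v n = (\<Sum>m\<in>?M. ?t m n)] (mod int p ^ n)"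
    unfolding mpoly_eval_def by (rule padic_finsum_level[OF p tc])
  also have "[(\<Sum>m\<in>?M. ?t m n) = (\<Sum>m\<in>?M. P m n * (\<Prod>i\<in>#m. v i n))] (mod int p ^ n)"
    using summand by (rule cong_sum)
  finally show "[mpoly_eval ?R P v n = (\<Sum>m\<in>?M. P m n * (\<Prod>i\<in>#m. v i n))] (mod int p ^ n)" .
qed

text \<open>
The operator \<open>\<phi>\<close> is the Jacobian matrix of \<open>f\<close> at the residue \<open>a\<close> modulo \<open>p\<^sup>K\<close>. The bound \<open>m\<close> on
the distance of the two points and the level \<open>N\<close> at which the congruence is read are arbitrary,
whereas \<open>\<phi>\<close> depends on neither.
\<close>

lemma padic_polynomial_map_linearization:
  assumes p: "p > 0"
    and f: "\<forall>j<d. f j \<in> ring.indexed_pset (padic_ints p) {..<d} (carrier (padic_ints p))"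
  obtains \<phi> where "integral_operator d \<phi>"
    "\<And>m N u v. u \<in> {..<d} \<rightarrow>\<^sub>E carrier (padic_ints p) \<Longrightarrow> v \<in> {..<d} \<rightarrow>\<^sub>E carrier (padic_ints p) \<Longrightarrow>
       m + K \<le> N \<Longrightarrow>
       vec_cong d (int p ^ K) (\<lambda>c. u c N) a \<Longrightarrow> vec_cong d (int p ^ K) (\<lambda>c. v c N) a \<Longrightarrow>
       vec_cong d (int p ^ m) (\<lambda>c. u c N) (\<lambda>c. v c N) \<Longrightarrow>
       vec_cong d (int p ^ (m + K))
         (\<lambda>c. mpoly_map (padic_ints p) d f u c N - mpoly_map (padic_ints p) d f v c N)
         (\<phi> (\<lambda>c. u c N - v c N))"
proof -
  let ?R = "padic_ints p"
  interpret R: cring ?R using p by (rule padic_ints_cring)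
  let ?M = "\<lambda>j. {m. f j m \<noteq> \<zero>\<^bsub>?R\<^esub>}"
  let ?val = "\<lambda>j b s. \<Sum>m\<in>?M j. b m * (\<Prod>i\<in>#m. s i)"
  let ?lin = "\<lambda>j G. \<forall>q s t b. (\<forall>m\<in>?M j. [b m = f j m K] (mod int p ^ K)) \<longrightarrow>
           vec_cong d (int p ^ K) s a \<longrightarrow> vec_cong d (int p ^ K) t a \<longrightarrow> vec_cong d q s t \<longrightarrow>
           [?val j b s - ?val j b t = (\<Sum>i<d. G i * (s i - t i))] (mod (q * int p ^ K))"
  have "\<forall>j. \<exists>G. j < d \<longrightarrow> ?lin j G"
  proof
    fix j
    show "\<exists>G. j < d \<longrightarrow> ?lin j G"
  proof (cases "j < d")
    case True
    have "set_mset m \<subseteq> {..<d}" if "m \<in> ?M j" for m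
      using R.indexed_pset_variables[of "f j" "{..<d}" m] f True that by simp
    from polynomial_linearization[OF this, of "?M j" "\<lambda>m. f j m K" "int p ^ K" a]
    show ?thesis by simp
  qed simp
  qed
  then obtain G where G: "\<forall>j. j < d \<longrightarrow> ?lin j (G j)" by (rule exE[OF choice])
  show thesis
  proof (rule that)
    show "integral_operator d (\<lambda>u r. \<Sum>c<d. G r c * u c)" by (rule integral_operator_matrix)
  next
    fix m N u v
    assume uv: "u \<in> {..<d} \<rightarrow>\<^sub>E carrier ?R" "v \<in> {..<d} \<rightarrow>\<^sub>E carrier ?R" and N: "m + K \<le> N"
      and c: "vec_cong d (int p ^ K) (\<lambda>c. u c N) a" "vec_cong d (int p ^ K) (\<lambda>c. v c N) a"
             "vec_cong d (int p ^ m) (\<lambda>c. u c N) (\<lambda>c. v c N)"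
    have "[mpoly_map ?R d f u j N - mpoly_map ?R d f v j N =
           (\<Sum>c<d. G j c * (u c N - v c N))] (mod (int p ^ (m + K)))" if j: "j < d" for j
    proof -
      have P: "f j \<in> R.indexed_pset {..<d} (carrier ?R)" using f j by simp
      have val: "[mpoly_map ?R d f w j N = ?val j (\<lambda>m. f j m N) (\<lambda>i. w i N)]
             (mod int p ^ (m + K))" if w: "w \<in> {..<d} \<rightarrow>\<^sub>E carrier ?R" for w
        using cong_dvd_modulus[OF padic_polynomial_value(2)[OF p P w, of N], of "int p ^ (m + K)"] N j
        by (simp add: mpoly_map_def le_imp_power_dvd)
      have co: "f j m \<in> carrier ?R" for m
        using R.indexed_pset_in_carrier[OF _ P] by (simp add: R.carrier_coeff_def)
      have "[mpoly_map ?R d f u j N - mpoly_map ?R d f v j N =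
             ?val j (\<lambda>m. f j m N) (\<lambda>i. u i N) - ?val j (\<lambda>m. f j m N) (\<lambda>i. v i N)]
             (mod int p ^ (m + K))"
        by (intro cong_diff val uv)
      also have "[?val j (\<lambda>m. f j m N) (\<lambda>i. u i N) - ?val j (\<lambda>m. f j m N) (\<lambda>i. v i N) =
             (\<Sum>c<d. G j c * (u c N - v c N))] (mod int p ^ (m + K))"
        unfolding power_add
        by (rule G[rule_format, OF j _ c]) (use padic_level_cong[OF co, of K N] N in auto)
      finally show ?thesis .
    qed
    thus "vec_cong d (int p ^ (m + K)) (\<lambda>c. mpoly_map ?R d f u c N - mpoly_map ?R d f v c N)
            (\<lambda>r. \<Sum>c<d. G r c * (u c N - v c N))"
      by (simp add: vec_cong_def)
  qed
qed

section \<open>Sequences with small second differences\<close>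

text \<open>
From time \<open>S\<close> on, all increments \<open>z (t + 1) - z t\<close> have valuation exactly \<open>\<mu>\<close>. By the hypothesis on second
differences they are constant modulo \<open>p\<^sup>\<mu>\<^sup>+\<^sup>2\<close>, so \<open>z (t + p) - z t\<close> is congruent to \<open>p\<close> times an
increment and has valuation exactly \<open>\<mu> + 1\<close>. The same argument applies to the shift by \<open>p\<close>
in place of the shift by \<open>1\<close>, and so on. Each round costs one time step, because second
differences at time \<open>s\<close> are controlled by the first differences at time \<open>s - 1\<close>. The gain of
two digits in the hypothesis is needed because multiplication by \<open>p\<close> uses up one of them.
\<close>

lemma differences_of_prime_power_shifts:
  fixes z :: "nat \<Rightarrow> nat \<Rightarrow> int" and p :: nat
  assumes p: "p \<ge> 1"
    and sd: "\<And>m i j. m + 2 \<le> N \<Longrightarrow> vec_cong d (int p ^ m) (z i) (z j) \<Longrightarrow>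
               vec_cong d (int p ^ (m + 2)) (\<lambda>c. z (i + 2) c - z (j + 2) c)
                                            (\<lambda>c. z (i + 1) c - z (j + 1) c)"
    and base: "\<And>t. t \<ge> S \<Longrightarrow> vec_cong d (int p ^ \<mu>) (z (t + 1)) (z t)"
              "\<And>t. t \<ge> S \<Longrightarrow> \<not> vec_cong d (int p ^ (\<mu> + 1)) (z (t + 1)) (z t)"
  shows "\<mu> + k + 1 \<le> N \<Longrightarrow> t \<ge> S + k \<Longrightarrow>
           vec_cong d (int p ^ (\<mu> + k)) (z (t + p ^ k)) (z t) \<and>
           \<not> vec_cong d (int p ^ (\<mu> + k + 1)) (z (t + p ^ k)) (z t)"
proof (induction k arbitrary: t)
  case 0
  thus ?case using base[of t] by simp
next
  case (Suc k)
  let ?n = "\<mu> + k"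
  define E where "E = (\<lambda>s c. z (s + p ^ k) c - z s c)"
  have IH: "vec_cong d (int p ^ ?n) (z (s + p ^ k)) (z s)"
           "\<not> vec_cong d (int p ^ (?n + 1)) (z (s + p ^ k)) (z s)" if "s \<ge> S + k" for s
    using Suc.IH[of s] Suc.prems(1) that by auto
  have E_step: "vec_cong d (int p ^ (?n + 2)) (E (Suc s)) (E s)" if "s \<ge> S + Suc k" for s
  proof -
    have "S + k \<le> s - 1" using that by simp
    from sd[OF _ IH(1)[OF this]] that Suc.prems(1) show ?thesis
      by (cases s) (simp_all add: E_def add.commute)
  qed
  have E_const: "vec_cong d (int p ^ (?n + 2)) (E (t + i)) (E t)" for i
  proof (induction i)
    case (Suc i)
    show ?case using vec_cong_trans[OF E_step[of "t + i"] Suc] \<open>t \<ge> S + Suc k\<close> by simp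
  qed simp
  have sum: "[z (t + p ^ Suc k) c - z t c = int p * E t c] (mod int p ^ (?n + 2))" if "c < d" for c
  proof -
    have "z (t + p ^ Suc k) c - z t c = (\<Sum>i<p. E (t + i * p ^ k) c)"
      using sum_lessThan_telescope[of "\<lambda>i. z (t + i * p ^ k) c" p]
      by (simp add: E_def ac_simps)
    also have "[\<dots> = (\<Sum>i<p. E t c)] (mod int p ^ (?n + 2))"
      using E_const that by (intro cong_sum) (auto simp: vec_cong_def)
    finally show ?thesis by simp
  qed
  have E_dvd: "(\<forall>c<d. int p ^ l dvd E t c) \<longleftrightarrow> vec_cong d (int p ^ l) (z (t + p ^ k)) (z t)" for l
    by (auto simp: vec_cong_def cong_iff_dvd_diff E_def)
  have lift: "vec_cong d (int p ^ (l + 1)) (z (t + p ^ Suc k)) (z t) \<longleftrightarrow>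
              vec_cong d (int p ^ l) (z (t + p ^ k)) (z t)" if "l \<le> ?n + 1" for l
  proof -
    have "int p ^ (l + 1) dvd z (t + p ^ Suc k) c - z t c \<longleftrightarrow> int p ^ l dvd E t c" if c: "c < d" for c
    proof -
      have "[z (t + p ^ Suc k) c - z t c = int p * E t c] (mod int p ^ (l + 1))"
        by (rule cong_dvd_modulus[OF sum[OF c] le_imp_power_dvd]) (use \<open>l \<le> _\<close> in simp)
      hence "int p ^ (l + 1) dvd z (t + p ^ Suc k) c - z t c \<longleftrightarrow> int p ^ (l + 1) dvd int p * E t c"
        by (rule cong_dvd_iff)
      thus ?thesis using p by simp
    qed
    thus ?thesis unfolding E_dvd[symmetric] by (auto simp: vec_cong_def cong_iff_dvd_diff)
  qed
  show ?case using lift[of ?n] lift[of "?n + 1"] IH[of t] Suc.prems(2) by (simp add: add.commute)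
qed

text \<open>
The orbit of a point of \<open>\<int>\<^sub>p\<^sup>d\<close> under a map that induces maps modulo all powers of \<open>p\<close>: \<open>y i n\<close> is the
\<open>i\<close>-th point modulo \<open>p\<^sup>n\<close>, given by integer representatives of its coordinates. Differences of
points can then be formed by subtraction of integers.
\<close>

locale coherent_sequence =
  fixes d p :: nat and y :: "nat \<Rightarrow> nat \<Rightarrow> nat \<Rightarrow> int"
  assumes p_pos: "p \<ge> 1"
    and coherent: "n \<le> N \<Longrightarrow> vec_cong d (int p ^ n) (y i N) (y i n)"
    and autonomous: "vec_cong d (int p ^ n) (y i n) (y j n) \<Longrightarrow>
                       vec_cong d (int p ^ n) (y (Suc i) n) (y (Suc j) n)"
begin

lemma level:
  "n \<le> N \<Longrightarrow> vec_cong d (int p ^ n) (y i N) (y j N) \<longleftrightarrow> vec_cong d (int p ^ n) (y i n) (y j n)"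
  using coherent by (meson vec_cong_sym vec_cong_trans)

lemma autonomous_add:
  "vec_cong d (int p ^ n) (y i n) (y j n) \<Longrightarrow> vec_cong d (int p ^ n) (y (i + l) n) (y (j + l) n)"
  by (induction l) (auto dest: autonomous)

lemma subsequence: "coherent_sequence d p (\<lambda>k. y (t + k * L))"
proof unfold_locales
  fix i j n
  assume "vec_cong d (int p ^ n) (y (t + i * L) n) (y (t + j * L) n)"
  from autonomous_add[OF this, of L]
  show "vec_cong d (int p ^ n) (y (t + Suc i * L) n) (y (t + Suc j * L) n)"
    by (simp add: ac_simps)
qed (use p_pos coherent in auto)

text \<open>
Write \<open>v s\<close> for the valuation of the increment at time \<open>s\<close>. Either \<open>v s \<ge> s\<close> for all \<open>s\<close>, and the sequence
converges, or this fails for the first time at some \<open>s = \<mu> + 1\<close>. Valuations of increments never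
decrease, so in the second case \<open>v s \<ge> \<mu>\<close> from time \<open>\<mu>\<close> on, and from time \<open>\<mu> + 1\<close> on the increments
no longer change modulo \<open>p\<^sup>\<mu>\<^sup>+\<^sup>2\<close>. As the one at time \<open>\<mu> + 1\<close> is nonzero modulo \<open>p\<^sup>\<mu>\<^sup>+\<^sup>1\<close>, all later
ones have valuation exactly \<open>\<mu>\<close>, and lemma \<open>differences_of_prime_power_shifts\<close> applies.
\<close>

lemma second_difference_dichotomy:
  assumes sd: "\<And>N m i j. m + 2 \<le> N \<Longrightarrow> vec_cong d (int p ^ m) (y i N) (y j N) \<Longrightarrow>
               vec_cong d (int p ^ (m + 2)) (\<lambda>c. y (i + 2) N c - y (j + 2) N c)
                                            (\<lambda>c. y (i + 1) N c - y (j + 1) N c)"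
  obtains (contracting) "\<And>s. vec_cong d (int p ^ s) (y (s + 1) s) (y s s)"
  | (drifting) \<mu> where
      "\<And>k t. t \<ge> \<mu> + 1 + k \<Longrightarrow>
         vec_cong d (int p ^ (\<mu> + k)) (y (t + p ^ k) (\<mu> + k)) (y t (\<mu> + k))"
      "\<And>k t. t \<ge> \<mu> + 1 + k \<Longrightarrow>
         \<not> vec_cong d (int p ^ (\<mu> + k + 1)) (y (t + p ^ k) (\<mu> + k + 1)) (y t (\<mu> + k + 1))"
proof (cases "\<forall>s. vec_cong d (int p ^ s) (y (s + 1) s) (y s s)")
  case True
  thus ?thesis using contracting by blast
next
  case False
  define s where "s = (LEAST s. \<not> vec_cong d (int p ^ s) (y (s + 1) s) (y s s))"
  have s: "\<not> vec_cong d (int p ^ s) (y (s + 1) s) (y s s)"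
    unfolding s_def by (rule LeastI_ex) (use False in blast)
  have "s \<noteq> 0"
  proof
    assume "s = 0"
    with s show False by (simp add: vec_cong_def)
  qed
  then obtain \<mu> where \<mu>: "s = Suc \<mu>" by (cases s) auto
  have small0: "vec_cong d (int p ^ \<mu>) (y (\<mu> + 1) \<mu>) (y \<mu> \<mu>)"
    using not_less_Least[of \<mu> "\<lambda>s. \<not> vec_cong d (int p ^ s) (y (s + 1) s) (y s s)"] \<mu>
    by (simp add: s_def)
  have small: "vec_cong d (int p ^ \<mu>) (y (t + 1) \<mu>) (y t \<mu>)" if "t \<ge> \<mu>" for t
    using that
  proof (induction t rule: dec_induct)
    case base
    show ?case by (rule small0)
  next
    case (step t)
    show ?case using autonomous[OF step.IH] by simp
  qed
  have large: "\<not> vec_cong d (int p ^ (\<mu> + 1)) (y (t + 1) (\<mu> + 1)) (y t (\<mu> + 1))" if "t \<ge> \<mu> + 1" for t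
    using that
  proof (induction t rule: dec_induct)
    case base
    show ?case using s \<mu> by simp
  next
    case (step t)
    have "vec_cong d (int p ^ (\<mu> + 2)) (\<lambda>c. y (t + 2) (\<mu> + 2) c - y (t + 1) (\<mu> + 2) c)
            (\<lambda>c. y (t + 1) (\<mu> + 2) c - y t (\<mu> + 2) c)"
      using sd[of \<mu> "\<mu> + 2" t "t - 1"] small[of "t - 1"] level[of \<mu> "\<mu> + 2"] step.hyps
      by (cases t) simp_all
    hence "vec_cong d (int p ^ (\<mu> + 1)) (\<lambda>c. y (t + 2) (\<mu> + 2) c - y (t + 1) (\<mu> + 2) c)
            (\<lambda>c. y (t + 1) (\<mu> + 2) c - y t (\<mu> + 2) c)"
      by (rule vec_cong_dvd) (simp add: le_imp_power_dvd)
    moreover have "\<not> vec_cong d (int p ^ (\<mu> + 1)) (y (t + 1) (\<mu> + 2)) (y t (\<mu> + 2))"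
      using step.IH level[of "\<mu> + 1" "\<mu> + 2"] by simp
    ultimately have "\<not> vec_cong d (int p ^ (\<mu> + 1)) (y (t + 2) (\<mu> + 2)) (y (t + 1) (\<mu> + 2))"
      unfolding vec_cong_def cong_iff_dvd_diff by (meson dvd_diff_right_iff)
    thus ?case using level[of "\<mu> + 1" "\<mu> + 2"] by simp
  qed
  have *: "vec_cong d (int p ^ (\<mu> + k)) (y (t + p ^ k) (\<mu> + k + 1)) (y t (\<mu> + k + 1)) \<and>
        \<not> vec_cong d (int p ^ (\<mu> + k + 1)) (y (t + p ^ k) (\<mu> + k + 1)) (y t (\<mu> + k + 1))"
    if t: "t \<ge> \<mu> + 1 + k" for k t
  proof (rule differences_of_prime_power_shifts[where z = "\<lambda>i. y i (\<mu> + k + 1)"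
        and S = "\<mu> + 1" and N = "\<mu> + k + 1", OF p_pos])
    show "vec_cong d (int p ^ \<mu>) (y (t + 1) (\<mu> + k + 1)) (y t (\<mu> + k + 1))" if "t \<ge> \<mu> + 1" for t
      using small[of t] that level[of \<mu> "\<mu> + k + 1"] by simp
    show "\<not> vec_cong d (int p ^ (\<mu> + 1)) (y (t + 1) (\<mu> + k + 1)) (y t (\<mu> + k + 1))"
      if "t \<ge> \<mu> + 1" for t
      using large[of t] that level[of "\<mu> + 1" "\<mu> + k + 1"] by simp
  qed (use sd t in auto)
  show ?thesis
  proof (rule drifting)
    fix k t assume "\<mu> + 1 + k \<le> t"
    from *[OF this]
    show "vec_cong d (int p ^ (\<mu> + k)) (y (t + p ^ k) (\<mu> + k)) (y t (\<mu> + k))"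
      "\<not> vec_cong d (int p ^ (\<mu> + k + 1)) (y (t + p ^ k) (\<mu> + k + 1)) (y t (\<mu> + k + 1))"
      using level[of "\<mu> + k" "\<mu> + k + 1"] by auto
  qed
qed

text \<open>
One operator serves all pairs of points in a residue class modulo \<open>p\<^sup>K\<close>, whatever their distance \<open>m\<close>
and the level \<open>N\<close>. This uniformity makes the constants of the final bounds independent of the level.
\<close>

definition linearizes ::
  "nat \<Rightarrow> (nat \<Rightarrow> int) \<Rightarrow> nat \<Rightarrow> ((nat \<Rightarrow> int) \<Rightarrow> (nat \<Rightarrow> int)) \<Rightarrow> bool" where
  "linearizes K a l \<phi> \<longleftrightarrow> integral_operator d \<phi> \<and> (\<forall>m N i j. m + K \<le> N \<longrightarrow>
      vec_cong d (int p ^ K) (y i N) a \<longrightarrow> vec_cong d (int p ^ K) (y j N) a \<longrightarrow>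
      vec_cong d (int p ^ m) (y i N) (y j N) \<longrightarrow>
      vec_cong d (int p ^ (m + K)) (\<lambda>c. y (i + l) N c - y (j + l) N c) (\<phi> (\<lambda>c. y i N c - y j N c)))"

lemma linearizesD:
  assumes "linearizes K a l \<phi>"
  shows "integral_operator d \<phi>"
    "m + K \<le> N \<Longrightarrow> vec_cong d (int p ^ K) (y i N) a \<Longrightarrow> vec_cong d (int p ^ K) (y j N) a \<Longrightarrow>
     vec_cong d (int p ^ m) (y i N) (y j N) \<Longrightarrow>
     vec_cong d (int p ^ (m + K)) (\<lambda>c. y (i + l) N c - y (j + l) N c) (\<phi> (\<lambda>c. y i N c - y j N c))"
  using assms by (auto simp: linearizes_def)

text \<open>
Chain rule. The residues modulo \<open>p\<^sup>K\<close> that are visited by a point in the class of \<open>y b\<close> are those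
visited by \<open>y b\<close> itself, so the product of the one-step operators along that path is the same for
all points of the class.
\<close>

lemma linearization_along_orbit:
  assumes lin: "\<And>a. \<exists>\<phi>. linearizes K a 1 \<phi>"
  shows "\<exists>\<phi>. linearizes K (y b K) l \<phi>"
proof (induction l)
  case 0
  show ?case by (rule exI[of _ "\<lambda>u. u"]) (simp add: linearizes_def integral_operator_id)
next
  case (Suc l)
  then obtain \<phi> where \<phi>: "linearizes K (y b K) l \<phi>" by blast
  obtain \<psi> where \<psi>: "linearizes K (y (b + l) K) 1 \<psi>" using lin by blast
  have "linearizes K (y b K) (Suc l) (\<lambda>u. \<psi> (\<phi> u))"
    unfolding linearizes_def
  proof (intro conjI allI impI)
    show "integral_operator d (\<lambda>u. \<psi> (\<phi> u))"
      by (rule integral_operator_comp[OF linearizesD(1)[OF \<psi>] linearizesD(1)[OF \<phi>]])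
  next
    fix m N i j
    assume N: "m + K \<le> N"
      and i: "vec_cong d (int p ^ K) (y i N) (y b K)"
      and j: "vec_cong d (int p ^ K) (y j N) (y b K)"
      and ij: "vec_cong d (int p ^ m) (y i N) (y j N)"
    have res: "vec_cong d (int p ^ K) (y (h + l) N) (y (b + l) K)"
      if "vec_cong d (int p ^ K) (y h N) (y b K)" for h
    proof -
      have KN: "K \<le> N" using N by simp
      have "vec_cong d (int p ^ K) (y h K) (y b K)"
        using that coherent[OF KN] by (meson vec_cong_sym vec_cong_trans)
      from autonomous_add[OF this, of l] show ?thesis
        using coherent[OF KN] by (meson vec_cong_trans)
    qed
    have "vec_cong d (int p ^ m) (y (i + l) N) (y (j + l) N)"
      using ij N level[of m N] autonomous_add[of m i j l] by simp
    from linearizesD(2)[OF \<psi> N res[OF i] res[OF j] this]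
    have "vec_cong d (int p ^ (m + K)) (\<lambda>c. y (i + Suc l) N c - y (j + Suc l) N c)
            (\<psi> (\<lambda>c. y (i + l) N c - y (j + l) N c))" by simp
    moreover have "vec_cong d (int p ^ (m + K)) (\<psi> (\<lambda>c. y (i + l) N c - y (j + l) N c))
            (\<psi> (\<phi> (\<lambda>c. y i N c - y j N c)))"
      by (rule integral_operatorD(1)[OF linearizesD(1)[OF \<psi>] linearizesD(2)[OF \<phi> N i j ij]])
    ultimately show "vec_cong d (int p ^ (m + K)) (\<lambda>c. y (i + Suc l) N c - y (j + Suc l) N c)
            (\<psi> (\<phi> (\<lambda>c. y i N c - y j N c)))" by (rule vec_cong_trans)
  qed
  thus ?case by blast
qed

lemma eventually_recurrent: "\<exists>t T. T \<ge> 1 \<and> vec_cong d (int p ^ K) (y (t + T) K) (y t K)"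
proof -
  define red where "red = (\<lambda>i. \<lambda>c\<in>{..<d}. y i K c mod int p ^ K)"
  have "range red \<subseteq> {..<d} \<rightarrow>\<^sub>E {0..<int p ^ K}" using p_pos by (auto simp: red_def split: if_splits)
  hence "finite (range red)" by (rule finite_subset) (auto intro: finite_PiE)
  hence "\<not> inj red" using finite_imageD[of red UNIV] by auto
  then obtain i j where ij: "i \<noteq> j" "red i = red j" by (auto simp: inj_def)
  have cong: "vec_cong d (int p ^ K) (y i K) (y j K)"
    unfolding vec_cong_def cong_def
    using fun_cong[OF ij(2)] by (metis lessThan_iff red_def restrict_apply')
  show ?thesis
  proof (cases "i < j")
    case True
    thus ?thesis using vec_cong_sym[OF cong] by (intro exI[of _ i] exI[of _ "j - i"]) simp
  next
    case False
    thus ?thesis using cong ij(1) by (intro exI[of _ j] exI[of _ "i - j"]) simp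
  qed
qed

text \<open>
The residues modulo \<open>p\<^sup>K\<close> eventually repeat with some period \<open>T\<close>, and along the subsequence of step \<open>T\<close>
a single operator \<open>\<phi>\<close> linearizes every step. If \<open>\<phi>\<^sup>n\<close> is idempotent modulo \<open>p\<^sup>K\<close>, then along the
subsequence of step \<open>L = n * T\<close> two steps have the same effect on differences as one step, up
to an error of relative size \<open>p\<^sup>K\<close>.
\<close>

lemma second_differences_of_subsequence:
  assumes lin: "\<And>a. \<exists>\<phi>. linearizes K a 1 \<phi>"
  obtains t L where "L \<ge> 1"
    "\<And>m N i j. m + K \<le> N \<Longrightarrow> vec_cong d (int p ^ m) (y (t + i * L) N) (y (t + j * L) N) \<Longrightarrow>
       vec_cong d (int p ^ (m + K)) (\<lambda>c. y (t + (i + 2) * L) N c - y (t + (j + 2) * L) N c)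
                                    (\<lambda>c. y (t + (i + 1) * L) N c - y (t + (j + 1) * L) N c)"
proof -
  obtain t T where T: "T \<ge> 1" "vec_cong d (int p ^ K) (y (t + T) K) (y t K)"
    using eventually_recurrent by blast
  have recur: "vec_cong d (int p ^ K) (y (t + k * T) K) (y t K)" for k
  proof (induction k)
    case (Suc k)
    from autonomous_add[OF this, of T] T(2)
    have "vec_cong d (int p ^ K) (y (t + k * T + T) K) (y t K)" by (rule vec_cong_trans)
    thus ?case by (simp add: ac_simps)
  qed simp
  obtain \<phi> where lin_T: "linearizes K (y t K) T \<phi>"
    using linearization_along_orbit[OF lin] by blast
  note \<phi> = linearizesD[OF lin_T]
  obtain n where n: "n \<ge> 1" "\<And>u. vec_cong d (int p ^ K) ((\<phi> ^^ (2 * n)) u) ((\<phi> ^^ n) u)"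
    using idempotent_power_mod[OF \<phi>(1), of "int p ^ K"] p_pos by auto
  define z where "z = (\<lambda>k. y (t + k * T))"
  interpret z: coherent_sequence d p z unfolding z_def by (rule subsequence)
  have iterate: "vec_cong d (int p ^ (m + K)) (\<lambda>c. z (i + l) N c - z (j + l) N c)
               ((\<phi> ^^ l) (\<lambda>c. z i N c - z j N c))"
    if N: "m + K \<le> N" and ij: "vec_cong d (int p ^ m) (z i N) (z j N)" for m N i j l
  proof (induction l)
    case (Suc l)
    have near: "vec_cong d (int p ^ m) (z (i + l) N) (z (j + l) N)"
      using ij N z.level[of m N] z.autonomous_add[of m i j l] by simp
    have res: "vec_cong d (int p ^ K) (y (t + k * T) N) (y t K)" for k
      using recur[of k] coherent[of K N "t + k * T"] N by (meson add_leD2 vec_cong_trans)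
    have "vec_cong d (int p ^ (m + K)) (\<lambda>c. z (i + Suc l) N c - z (j + Suc l) N c)
            (\<phi> (\<lambda>c. z (i + l) N c - z (j + l) N c))"
      using \<phi>(2)[OF N res res near[unfolded z_def]] by (simp add: z_def ac_simps)
    moreover have "vec_cong d (int p ^ (m + K)) (\<phi> (\<lambda>c. z (i + l) N c - z (j + l) N c))
            (\<phi> ((\<phi> ^^ l) (\<lambda>c. z i N c - z j N c)))"
      by (rule integral_operatorD(1)[OF \<phi>(1) Suc])
    ultimately show ?case using vec_cong_trans by simp
  qed simp
  show ?thesis
  proof (rule that[of "n * T" t])
    show "n * T \<ge> 1" using n(1) T(1) by simp
  next
    fix m N i j
    assume N: "m + K \<le> N"
      and "vec_cong d (int p ^ m) (y (t + i * (n * T)) N) (y (t + j * (n * T)) N)"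
    hence ij: "vec_cong d (int p ^ m) (z (i * n) N) (z (j * n) N)" by (simp add: z_def mult.assoc)
    let ?e = "\<lambda>c. z (i * n) N c - z (j * n) N c"
    have "vec_cong d (int p ^ m) ?e (\<lambda>_. 0)"
      using ij by (simp add: vec_cong_def cong_iff_dvd_diff)
    from idempotent_power_scaled[OF \<phi>(1) n(2) this]
    have "vec_cong d (int p ^ (m + K)) ((\<phi> ^^ (2 * n)) ?e) ((\<phi> ^^ n) ?e)"
      by (simp add: power_add)
    hence "vec_cong d (int p ^ (m + K))
        (\<lambda>c. z (i * n + 2 * n) N c - z (j * n + 2 * n) N c) (\<lambda>c. z (i * n + n) N c - z (j * n + n) N c)"
      using iterate[OF N ij] by (meson vec_cong_sym vec_cong_trans)
    moreover have "(i + 2) * (n * T) = (i * n + 2 * n) * T" "(i + 1) * (n * T) = (i * n + n) * T" for i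
      by (simp_all add: algebra_simps)
    ultimately show "vec_cong d (int p ^ (m + K))
            (\<lambda>c. y (t + (i + 2) * (n * T)) N c - y (t + (j + 2) * (n * T)) N c)
            (\<lambda>c. y (t + (i + 1) * (n * T)) N c - y (t + (j + 1) * (n * T)) N c)"
      by (simp only: z_def)
  qed
qed

end

section \<open>Orbits of polynomial maps\<close>

lemma mpoly_map_closed:
  assumes "p > 0"
    and "\<forall>j<d. f j \<in> ring.indexed_pset (padic_ints p) {..<d} (carrier (padic_ints p))"
    and "v \<in> {..<d} \<rightarrow>\<^sub>E carrier (padic_ints p)"
  shows "mpoly_map (padic_ints p) d f v \<in> {..<d} \<rightarrow>\<^sub>E carrier (padic_ints p)"
  using assms padic_polynomial_value(1)[of p _ d v] by (auto simp: mpoly_map_def)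

lemma reduce_point_eq_iff:
  assumes "u \<in> {..<d} \<rightarrow>\<^sub>E carrier (padic_ints p)" "v \<in> {..<d} \<rightarrow>\<^sub>E carrier (padic_ints p)"
  shows "reduce_point d n u = reduce_point d n v \<longleftrightarrow>
           vec_cong d (int p ^ n) (\<lambda>c. u c n) (\<lambda>c. v c n)"
proof -
  have "u c n mod int p ^ n = u c n" "v c n mod int p ^ n = v c n" if "c < d" for c
    using that assms by (auto intro!: padic_ints_cong(2))
  thus ?thesis by (auto simp: reduce_point_def restrict_def fun_eq_iff vec_cong_def cong_def)
qed

lemma induced_map_iterate:
  assumes "p > 1" "n \<ge> 1"
    and f: "\<forall>j<d. f j \<in> ring.indexed_pset (padic_ints p) {..<d} (carrier (padic_ints p))"
    and x: "x \<in> {..<d} \<rightarrow>\<^sub>E carrier (padic_ints p)"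
  shows "(mpoly_map (padic_ints p) d f ^^ j) x \<in> {..<d} \<rightarrow>\<^sub>E carrier (padic_ints p)"
    "(induced_map p d f n ^^ j) (reduce_point d n x) =
       reduce_point d n ((mpoly_map (padic_ints p) d f ^^ j) x)"
proof -
  show closed: "(mpoly_map (padic_ints p) d f ^^ j) x \<in> {..<d} \<rightarrow>\<^sub>E carrier (padic_ints p)" for j
    using assms mpoly_map_closed[of p d f] by (induction j) simp_all
  show "(induced_map p d f n ^^ j) (reduce_point d n x) =
       reduce_point d n ((mpoly_map (padic_ints p) d f ^^ j) x)"
    using induced_map_reduce_point[OF assms(1-3) closed] by (induction j) simp_all
qed

text \<open>
The compatibility of \<open>f\<close> with reduction modulo \<open>p\<^sup>n\<close> is what makes the residues of the orbit
autonomous.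
\<close>

lemma padic_orbit_coherent_sequence:
  assumes p: "p > 1"
    and f: "\<forall>j<d. f j \<in> ring.indexed_pset (padic_ints p) {..<d} (carrier (padic_ints p))"
    and x: "x \<in> {..<d} \<rightarrow>\<^sub>E carrier (padic_ints p)"
  shows "coherent_sequence d p (\<lambda>j n c. (mpoly_map (padic_ints p) d f ^^ j) x c n)"
proof
  show "p \<ge> 1" using p by simp
next
  let ?Y = "\<lambda>j. (mpoly_map (padic_ints p) d f ^^ j) x"
  have closed: "?Y j \<in> {..<d} \<rightarrow>\<^sub>E carrier (padic_ints p)" for j
    using induced_map_iterate(1)[OF p _ f x] by blast
  show "vec_cong d (int p ^ n) (\<lambda>c. ?Y i c N) (\<lambda>c. ?Y i c n)" if "n \<le> N" for n N i
    using padic_level_cong[OF _ that] closed[of i] by (auto simp: vec_cong_def PiE_iff)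
  fix n i j
  assume ij: "vec_cong d (int p ^ n) (\<lambda>c. ?Y i c n) (\<lambda>c. ?Y j c n)"
  \<comment> \<open>The ring \<open>\<int>/p\<^sup>0\<close> is trivial, and induced maps are compatible with reduction for \<open>n \<ge> 1\<close> only.\<close>
  show "vec_cong d (int p ^ n) (\<lambda>c. ?Y (Suc i) c n) (\<lambda>c. ?Y (Suc j) c n)"
  proof (cases "n = 0")
    case True
    thus ?thesis by (simp add: vec_cong_def)
  next
    case False
    hence n: "n \<ge> 1" by simp
    have "reduce_point d n (?Y i) = reduce_point d n (?Y j)"
      using ij reduce_point_eq_iff[OF closed closed] by simp
    hence "reduce_point d n (?Y (Suc i)) = reduce_point d n (?Y (Suc j))"
      by (simp add: induced_map_reduce_point[OF p n f closed, symmetric])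
    thus ?thesis by (rule reduce_point_eq_iff[OF closed closed, THEN iffD1])
  qed
qed

text \<open>
The arithmetic core of the theorem, in terms of the induced maps alone. The constants \<open>t\<close>, \<open>L\<close> and
\<open>\<mu>\<close> come from the orbit modulo \<open>p\<^sup>2\<close> and from finitely many further digits, so they are uniform
in the level \<open>n\<close>.
\<close>

lemma polynomial_orbit_dichotomy:
  assumes p: "p > 1"
    and f: "\<forall>j<d. f j \<in> ring.indexed_pset (padic_ints p) {..<d} (carrier (padic_ints p))"
    and x: "x \<in> {..<d} \<rightarrow>\<^sub>E carrier (padic_ints p)"
  defines "orb \<equiv> \<lambda>n j. (induced_map p d f n ^^ j) (reduce_point d n x)"
  obtains (contracting) t L where "L \<ge> 1"
      "\<And>n. n \<ge> 1 \<Longrightarrow> orb n (t + n * L + L) = orb n (t + n * L)"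
  | (drifting) t L \<mu> where "L \<ge> 1"
      "\<And>n k s. n \<ge> 1 \<Longrightarrow> n \<le> \<mu> + k \<Longrightarrow> s \<ge> \<mu> + 1 + k \<Longrightarrow>
         orb n (t + s * L + p ^ k * L) = orb n (t + s * L)"
      "\<And>k s. s \<ge> \<mu> + 1 + k \<Longrightarrow>
         orb (\<mu> + k + 1) (t + s * L + p ^ k * L) \<noteq> orb (\<mu> + k + 1) (t + s * L)"
proof -
  let ?R = "padic_ints p"
  define Y where "Y = (\<lambda>j. (mpoly_map ?R d f ^^ j) x)"
  define y where "y = (\<lambda>j n c. Y j c n)"
  have p0: "p > 0" using p by simp
  have closed: "Y j \<in> {..<d} \<rightarrow>\<^sub>E carrier ?R" for j
    unfolding Y_def using induced_map_iterate(1)[OF p _ f x] by blast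
  have orb: "orb n i = orb n j \<longleftrightarrow> vec_cong d (int p ^ n) (y i n) (y j n)" if "n \<ge> 1" for n i j
    unfolding orb_def y_def
    using reduce_point_eq_iff[OF closed closed] induced_map_iterate(2)[OF p that f x]
    by (simp add: Y_def)
  interpret Y: coherent_sequence d p y
    unfolding y_def Y_def by (rule padic_orbit_coherent_sequence[OF p f x])
  have "\<exists>\<phi>. Y.linearizes 2 a 1 \<phi>" for a
  proof (rule padic_polynomial_map_linearization[OF p0 f, where K = 2 and a = a])
    fix \<phi>
    assume "integral_operator d \<phi>" and
      "\<And>m N u v. u \<in> {..<d} \<rightarrow>\<^sub>E carrier ?R \<Longrightarrow> v \<in> {..<d} \<rightarrow>\<^sub>E carrier ?R \<Longrightarrow> m + 2 \<le> N \<Longrightarrow>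
       vec_cong d (int p ^ 2) (\<lambda>c. u c N) a \<Longrightarrow> vec_cong d (int p ^ 2) (\<lambda>c. v c N) a \<Longrightarrow>
       vec_cong d (int p ^ m) (\<lambda>c. u c N) (\<lambda>c. v c N) \<Longrightarrow>
       vec_cong d (int p ^ (m + 2)) (\<lambda>c. mpoly_map ?R d f u c N - mpoly_map ?R d f v c N)
         (\<phi> (\<lambda>c. u c N - v c N))"
    from this(1) this(2)[OF closed closed]
    have "Y.linearizes 2 a 1 \<phi>" unfolding Y.linearizes_def by (auto simp: y_def Y_def)
    thus ?thesis by blast
  qed
  then obtain t L where L: "L \<ge> 1" and sd:
    "\<And>m N i j. m + 2 \<le> N \<Longrightarrow> vec_cong d (int p ^ m) (y (t + i * L) N) (y (t + j * L) N) \<Longrightarrow>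
       vec_cong d (int p ^ (m + 2)) (\<lambda>c. y (t + (i + 2) * L) N c - y (t + (j + 2) * L) N c)
                                    (\<lambda>c. y (t + (i + 1) * L) N c - y (t + (j + 1) * L) N c)"
    by (rule Y.second_differences_of_subsequence) (rule that)
  interpret W: coherent_sequence d p "\<lambda>k. y (t + k * L)" by (rule Y.subsequence)
  show thesis
  proof (rule W.second_difference_dichotomy[OF sd])
    assume *: "\<And>s. vec_cong d (int p ^ s) (y (t + (s + 1) * L) s) (y (t + s * L) s)"
    show thesis
      by (rule contracting[OF L, of t]) (use * in \<open>simp add: orb ac_simps\<close>)
  next
    fix \<mu>
    assume near: "\<And>k s. s \<ge> \<mu> + 1 + k \<Longrightarrow> vec_cong d (int p ^ (\<mu> + k))
                    (y (t + (s + p ^ k) * L) (\<mu> + k)) (y (t + s * L) (\<mu> + k))"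
      and far: "\<And>k s. s \<ge> \<mu> + 1 + k \<Longrightarrow> \<not> vec_cong d (int p ^ (\<mu> + k + 1))
                    (y (t + (s + p ^ k) * L) (\<mu> + k + 1)) (y (t + s * L) (\<mu> + k + 1))"
    have split: "t + s * L + p ^ k * L = t + (s + p ^ k) * L" for s k by (simp add: algebra_simps)
    show thesis
    proof (rule drifting[OF L, of \<mu> t])
      fix n k s assume n: "n \<ge> 1" "n \<le> \<mu> + k" and s: "s \<ge> \<mu> + 1 + k"
      show "orb n (t + s * L + p ^ k * L) = orb n (t + s * L)"
        unfolding orb[OF n(1)] split
        using vec_cong_dvd[OF near[OF s] le_imp_power_dvd[OF n(2)]] Y.level[OF n(2)] by blast
    next
      fix k s assume s: "s \<ge> \<mu> + 1 + k"
      show "orb (\<mu> + k + 1) (t + s * L + p ^ k * L) \<noteq> orb (\<mu> + k + 1) (t + s * L)"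
        using far[OF s] orb[of "\<mu> + k + 1"] by (simp add: split)
    qed
  qed
qed

theorem theorem3:
  fixes p d :: nat
    and f :: "nat \<Rightarrow> nat multiset \<Rightarrow> padic"
    and x :: "nat \<Rightarrow> padic"
  assumes "prime p"
    and "d \<ge> 1"
    and "\<forall>j<d. f j \<in> ring.indexed_pset (padic_ints p) {..<d} (carrier (padic_ints p))"
    and "x \<in> {..<d} \<rightarrow>\<^sub>E carrier (padic_ints p)"
  shows "((\<exists>C0::real. \<forall>n\<ge>1. real (period (induced_map p d f n) (reduce_point d n x)) \<le> C0) \<or>
          (\<exists>C1 C2 :: real. C1 > 0 \<and> C2 > 0 \<and>
            (\<forall>n\<ge>1. C1 * real p ^ n \<le> real (period (induced_map p d f n) (reduce_point d n x)) \<and>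
                   real (period (induced_map p d f n) (reduce_point d n x)) \<le> C2 * real p ^ n)))
       \<and> (\<exists>C3::real. C3 \<ge> 0 \<and>
            (\<forall>n\<ge>1. real (tail_length (induced_map p d f n) (reduce_point d n x)) \<le> real n * C3))
       \<and> (\<lambda>n. real (card (forward_orbit (induced_map p d f n) (reduce_point d n x))))
            \<in> O(\<lambda>n. real p ^ n)"
proof -
  have p: "p > 1" using assms(1) by (rule prime_gt_1_nat)
  let ?g = "induced_map p d f" and ?s = "\<lambda>n. reduce_point d n x"
  let ?orb = "\<lambda>n j. (?g n ^^ j) (?s n)"
  let ?per = "\<lambda>n. period (?g n) (?s n)" and ?tail = "\<lambda>n. tail_length (?g n) (?s n)"
  have pow_pos: "real p ^ n \<ge> 1" for n using p by simp
  \<comment> \<open>Bounds on tails, upper bounds on periods and the orbit size all follow from a return time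
      of size \<open>O(p\<^sup>n)\<close> that is reached after \<open>O(n)\<close> steps.\<close>
  have final: ?thesis
    if ret: "\<And>n. n \<ge> 1 \<Longrightarrow> \<exists>T\<ge>1. \<exists>\<tau>. ?orb n (\<tau> + T) = ?orb n \<tau> \<and> \<tau> \<le> n * C3 \<and> T \<le> C2 * p ^ n"
      and dich: "(\<exists>C0::real. \<forall>n\<ge>1. real (?per n) \<le> C0) \<or>
                 (\<exists>C1>0. \<forall>n\<ge>1. C1 * real p ^ n \<le> real (?per n))"
    for C2 C3 :: nat
  proof -
    have bounds: "?tail n \<le> n * C3" "?per n \<le> C2 * p ^ n"
        "card (forward_orbit (?g n) (?s n)) \<le> (C2 + C3) * p ^ n" if n: "n \<ge> 1" for n
    proof -
      obtain T \<tau> where T: "?orb n (\<tau> + T) = ?orb n \<tau>" "T \<ge> 1" "\<tau> \<le> n * C3" "T \<le> C2 * p ^ n"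
        using ret[OF n] by blast
      note b = tail_period_bounds[OF T(1,2)]
      show tp: "?tail n \<le> n * C3" "?per n \<le> C2 * p ^ n" using b(1,2) T(3,4) by linarith+
      have "n \<le> p ^ n" using power_gt_expt[of p n] p by simp
      hence "n * C3 \<le> p ^ n * C3" by (rule mult_le_mono1)
      thus "card (forward_orbit (?g n) (?s n)) \<le> (C2 + C3) * p ^ n"
        using card_forward_orbit_le[OF T(1,2)] tp unfolding add_mult_distrib mult.commute[of C3]
        by linarith
    qed
    have up: "real (?per n) \<le> real (C2 + 1) * real p ^ n" if "n \<ge> 1" for n
    proof -
      have "real (?per n) \<le> real (C2 * p ^ n)" using bounds(2)[OF that] by (rule of_nat_mono)
      thus ?thesis using pow_pos[of n] by (simp add: algebra_simps)
    qed
    have 1: "((\<exists>C0::real. \<forall>n\<ge>1. real (?per n) \<le> C0) \<or>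
          (\<exists>C1 C2 :: real. C1 > 0 \<and> C2 > 0 \<and>
            (\<forall>n\<ge>1. C1 * real p ^ n \<le> real (?per n) \<and> real (?per n) \<le> C2 * real p ^ n)))"
      using dich
    proof
      assume "\<exists>C1>0. \<forall>n\<ge>1. C1 * real p ^ n \<le> real (?per n)"
      then obtain C1 where "C1 > 0" "\<forall>n\<ge>1. C1 * real p ^ n \<le> real (?per n)" by blast
      thus ?thesis using up by (intro disjI2 exI[of _ C1] exI[of _ "real (C2 + 1)"]) auto
    qed blast
    have 2: "\<exists>C3::real. C3 \<ge> 0 \<and> (\<forall>n\<ge>1. real (?tail n) \<le> real n * C3)"
      using bounds(1) by (intro exI[of _ "real C3"]) (auto simp flip: of_nat_mult)
    have 3: "(\<lambda>n. real (card (forward_orbit (?g n) (?s n)))) \<in> O(\<lambda>n. real p ^ n)"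
    proof (rule bigoI[of _ "real (C2 + C3)"])
      show "\<forall>\<^sub>F n in sequentially. norm (real (card (forward_orbit (?g n) (?s n)))) \<le>
              real (C2 + C3) * norm (real p ^ n)"
        using eventually_ge_at_top[of 1]
      proof eventually_elim
        case (elim n)
        have "real (card (forward_orbit (?g n) (?s n))) \<le> real ((C2 + C3) * p ^ n)"
          using bounds(3)[OF elim] by (rule of_nat_mono)
        thus ?case by simp
      qed
    qed
    from 1 2 3 show ?thesis by blast
  qed
  show ?thesis
  proof (rule polynomial_orbit_dichotomy[OF p assms(3,4)])
    fix t L
    assume L: "L \<ge> 1" and ret: "\<And>n. n \<ge> 1 \<Longrightarrow> ?orb n (t + n * L + L) = ?orb n (t + n * L)"
    show ?thesis
    proof (rule final[of "t + L" L])
      fix n :: nat assume n: "n \<ge> 1"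
      have "t + n * L \<le> n * (t + L)" using n by (simp add: algebra_simps)
      moreover have "L \<le> L * p ^ n" using p by simp
      ultimately show "\<exists>T\<ge>1. \<exists>\<tau>. ?orb n (\<tau> + T) = ?orb n \<tau> \<and> \<tau> \<le> n * (t + L) \<and> T \<le> L * p ^ n"
        using ret[OF n] L by blast
    next
      have "\<forall>n\<ge>1. real (?per n) \<le> real L" using tail_period_bounds(2)[OF ret L] by simp
      thus "(\<exists>C0::real. \<forall>n\<ge>1. real (?per n) \<le> C0) \<or>
                 (\<exists>C1>0. \<forall>n\<ge>1. C1 * real p ^ n \<le> real (?per n))" by blast
    qed
  next
    fix t L \<mu>
    assume L: "L \<ge> 1"
      and near: "\<And>n k s. n \<ge> 1 \<Longrightarrow> n \<le> \<mu> + k \<Longrightarrow> s \<ge> \<mu> + 1 + k \<Longrightarrow>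
         ?orb n (t + s * L + p ^ k * L) = ?orb n (t + s * L)"
      and far: "\<And>k s. s \<ge> \<mu> + 1 + k \<Longrightarrow>
         ?orb (\<mu> + k + 1) (t + s * L + p ^ k * L) \<noteq> ?orb (\<mu> + k + 1) (t + s * L)"
    have ret: "\<exists>T\<ge>1. \<exists>\<tau>. ?orb n (\<tau> + T) = ?orb n \<tau> \<and> \<tau> \<le> n * (t + (\<mu> + 2) * L) \<and> T \<le> L * p ^ n"
      if n: "n \<ge> 1" for n
    proof -
      let ?T = "p ^ n * L" and ?\<tau> = "t + (\<mu> + 1 + n) * L"
      have "?orb n (?\<tau> + ?T) = ?orb n ?\<tau>" by (rule near[OF n]) auto
      moreover have "?\<tau> \<le> n * (t + (\<mu> + 2) * L)"
      proof -
        obtain n' where "n = Suc n'" using n by (cases n) auto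
        thus ?thesis by (simp add: algebra_simps)
      qed
      moreover have "?T \<ge> 1" "?T \<le> L * p ^ n" using L p by simp_all
      ultimately show ?thesis by blast
    qed
    have low: "real (?per n) \<ge> inverse (real p ^ \<mu>) * real p ^ n" if n: "n \<ge> 1" for n
    proof -
      obtain T \<tau> where T: "?orb n (\<tau> + T) = ?orb n \<tau>" "T \<ge> 1" using ret[OF n] by blast
      note b = tail_period_bounds[OF T]
      show ?thesis
      proof (cases "n \<le> \<mu>")
        case True
        hence "inverse (real p ^ \<mu>) * real p ^ n \<le> 1"
          using p by (simp add: field_simps power_increasing)
        thus ?thesis using b(3) by simp
      next
        case False
        then obtain k where k: "n = \<mu> + Suc k" by (metis add_Suc_right less_imp_Suc_add not_le)
        \<comment> \<open>An index past the tail and large enough for both \<open>near\<close> with exponent \<open>k + 1\<close> and \<open>far\<close> with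
            exponent \<open>k\<close>. From there on \<open>?per n\<close> is a return time of \<open>?h\<close>, too.\<close>
        define s where "s = \<mu> + 2 + k + ?tail n"
        define a where "a = ?orb n (t + s * L)"
        let ?h = "?g n ^^ L"
        have iter: "(?h ^^ j) a = ?orb n (t + s * L + j * L)" for j
        proof -
          have "t + s * L + j * L = L * j + (t + s * L)" by (simp add: ac_simps)
          thus ?thesis by (simp only: a_def funpow_mult funpow_add[of "L * j"] comp_apply)
        qed
        have "p ^ Suc k \<le> ?per n"
        proof (rule prime_power_return_time_le[OF assms(1)])
          show "(?h ^^ (p ^ Suc k)) a = a"
            unfolding iter unfolding a_def by (rule near) (use n k s_def in auto)
          show "(?h ^^ (p ^ k)) a \<noteq> a"
            unfolding iter unfolding a_def using far[of k s] by (simp add: k s_def)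
          have "?tail n \<le> s * L" using L mult_le_mono[of "?tail n" s 1 L] by (simp add: s_def)
          hence "?orb n ((t + s * L) + L * ?per n) = ?orb n (t + s * L)"
            by (intro funpow_return_shift[OF b(4)]) simp
          thus "(?h ^^ ?per n) a = a" unfolding iter unfolding a_def by (simp add: mult.commute)
          show "?per n \<ge> 1" by (rule b(3))
        qed
        hence "real (p ^ Suc k) \<le> real (?per n)" by (rule of_nat_mono)
        moreover have "inverse (real p ^ \<mu>) * real p ^ n = real (p ^ Suc k)"
          using p by (simp add: k power_add)
        ultimately show ?thesis by simp
      qed
    qed
    show ?thesis
    proof (rule final[OF ret])
      have "inverse (real p ^ \<mu>) > 0" using p by simp
      thus "(\<exists>C0::real. \<forall>n\<ge>1. real (?per n) \<le> C0) \<or>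
                 (\<exists>C1>0. \<forall>n\<ge>1. C1 * real p ^ n \<le> real (?per n))" using low by blast
    qed
  qed
qed

end
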